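(* Let $\Omega:[0,\infty)\to[0,\infty)$ be non-increasing with $\Omega(t/2)\asymp\Omega(t)$ and $\Omega(t)\downarrow 0$ as $t\to\infty$. Then there exists a compact set $E\subset\mathbb{R}$ of positive Lebesgue measure such that: (i) There exists a nonzero positive measure $\mu\in M(E)$ with $$\widehat{\mu}\in\bigcap_{r>1}L^r(\mathbb{R}).$$ (ii) If $\nu\in M(E)$ satisfies $$|\widehat{\nu}(\xi)|\le\Omega(\xi),\qquad \xi>0,$$ then $\nu\equiv 0$.
   Context: For a compact set $E\subset\mathbb{R}$, $M(E)$ is the set of complex finite Borel measures on $\mathbb{R}$ supported in $E$. The Fourier transform is $\widehat{\mu}(\xi)=\int_{\mathbb{R}}e^{-ix\xi}\,d\mu(x)$, $\xi\in\mathbb{R}$. The notation $\Omega(t/2)\asymp\Omega(t)$ means that there is a constant $C\ge1$ with $C^{-1}\Omega(t)\le\Omega(t/2)\le C\,\Omega(t)$ for all $t\ge 0$. *)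

theory Defs
  imports "HOL-Analysis.Analysis"
begin

text \<open>
  A complex measure is a countably additive set function on the sigma-algebra of \<open>M\<close>; finiteness is
  automatic, and the values outside \<open>sets M\<close> are irrelevant.
\<close>

definition complex_measure :: "'a measure \<Rightarrow> ('a set \<Rightarrow> complex) \<Rightarrow> bool" where
  "complex_measure M \<nu> \<longleftrightarrow>
     (\<forall>A :: nat \<Rightarrow> 'a set. range A \<subseteq> sets M \<longrightarrow> disjoint_family A \<longrightarrow>
        (\<lambda>i. \<nu> (A i)) sums \<nu> (\<Union>i. A i))"

text \<open>
  The positive part of the Jordan decomposition of a signed measure \<open>\<sigma>\<close>; the negative part
  is the upper variation of \<open>-\<sigma>\<close>.  By \<open>emeasure_upper_variation\<close> below, the measure
  constructed here does take the stated values (it is not the degenerate zero measure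
  that \<^const>\<open>measure_of\<close> returns for set functions that are not measures).
\<close>

definition upper_variation :: "'a measure \<Rightarrow> ('a set \<Rightarrow> real) \<Rightarrow> 'a measure" where
  "upper_variation M \<sigma> =
     measure_of (space M) (sets M) (\<lambda>A. SUP B \<in> {B \<in> sets M. B \<subseteq> A}. ennreal (\<sigma> B))"

definition complex_measure_integral ::
    "'a measure \<Rightarrow> ('a set \<Rightarrow> complex) \<Rightarrow> ('a \<Rightarrow> complex) \<Rightarrow> complex" where
  "complex_measure_integral M \<nu> f =
     (integral\<^sup>L (upper_variation M (\<lambda>A. Re (\<nu> A))) f
        - integral\<^sup>L (upper_variation M (\<lambda>A. - Re (\<nu> A))) f)
     + \<i> * (integral\<^sup>L (upper_variation M (\<lambda>A. Im (\<nu> A))) f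
        - integral\<^sup>L (upper_variation M (\<lambda>A. - Im (\<nu> A))) f)"

definition measures_supported_in :: "real set \<Rightarrow> (real set \<Rightarrow> complex) set" where
  "measures_supported_in E =
     {\<nu>. complex_measure borel \<nu> \<and> (\<forall>A \<in> sets borel. A \<inter> E = {} \<longrightarrow> \<nu> A = 0)}"

definition fourier_transform :: "(real set \<Rightarrow> complex) \<Rightarrow> real \<Rightarrow> complex" where
  "fourier_transform \<nu> \<xi> =
     complex_measure_integral borel \<nu> (\<lambda>x. exp (- (\<i> * complex_of_real x * complex_of_real \<xi>)))"

definition Lp_functions :: "real \<Rightarrow> (real \<Rightarrow> complex) set" where
  "Lp_functions r =
     {f. f \<in> borel_measurable lborel \<and> integrable lborel (\<lambda>x. norm (f x) powr r)}"

lemma sums_signed_empty: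
  fixes \<sigma> :: "'a set \<Rightarrow> real"
  assumes "\<And>A :: nat \<Rightarrow> 'a set. range A \<subseteq> sets M \<Longrightarrow> disjoint_family A \<Longrightarrow>
             (\<lambda>i. \<sigma> (A i)) sums \<sigma> (\<Union>i. A i)"
  shows "\<sigma> {} = 0"
proof -
  have "(\<lambda>i::nat. \<sigma> {}) sums \<sigma> {}"
    using assms[of "\<lambda>_. {}"] by (simp add: disjoint_family_on_def)
  then have "summable (\<lambda>i::nat. \<sigma> {})" by (rule sums_summable)
  then show ?thesis by (simp add: summable_const_iff)
qed

lemma sums_signed_Un:
  fixes \<sigma> :: "'a set \<Rightarrow> real"
  assumes ca: "\<And>A :: nat \<Rightarrow> 'a set. range A \<subseteq> sets M \<Longrightarrow> disjoint_family A \<Longrightarrow>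
             (\<lambda>i. \<sigma> (A i)) sums \<sigma> (\<Union>i. A i)"
    and AB: "A \<in> sets M" "B \<in> sets M" "A \<inter> B = {}"
  shows "\<sigma> (A \<union> B) = \<sigma> A + \<sigma> B"
proof -
  have "range (binaryset A B) \<subseteq> sets M"
    using AB by (auto simp: binaryset_def)
  moreover have "disjoint_family (binaryset A B)"
    using AB by (auto simp: disjoint_family_on_def binaryset_def)
  ultimately have "(\<lambda>i. \<sigma> (binaryset A B i)) sums \<sigma> (A \<union> B)"
    using ca[of "binaryset A B"] by (simp add: UN_binaryset_eq)
  moreover have "(\<lambda>i. \<sigma> (binaryset A B i)) sums (\<sigma> A + \<sigma> B)"
    using sums_signed_empty[OF ca] by (intro binaryset_sums) auto
  ultimately show ?thesis by (rule sums_unique2)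
qed

lemma emeasure_upper_variation:
  fixes \<sigma> :: "'a set \<Rightarrow> real"
  assumes ca: "\<And>A :: nat \<Rightarrow> 'a set. range A \<subseteq> sets M \<Longrightarrow> disjoint_family A \<Longrightarrow>
             (\<lambda>i. \<sigma> (A i)) sums \<sigma> (\<Union>i. A i)"
    and X: "X \<in> sets M"
  shows "emeasure (upper_variation M \<sigma>) X = (SUP B \<in> {B \<in> sets M. B \<subseteq> X}. ennreal (\<sigma> B))"
proof -
  define p where "p A = (SUP B \<in> {B \<in> sets M. B \<subseteq> A}. ennreal (\<sigma> B))" for A
  have s0: "\<sigma> {} = 0" by (rule sums_signed_empty[OF ca])
  have pI: "ennreal (\<sigma> B) \<le> p A" if "B \<in> sets M" "B \<subseteq> A" for A B
    unfolding p_def using that by (intro SUP_upper) auto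
  have pmono: "p A \<le> p B" if "A \<subseteq> B" for A B
    unfolding p_def using that by (intro SUP_subset_mono) auto
  have padd: "p A + p B \<le> p (A \<union> B)" if AB: "A \<inter> B = {}" for A B
  proof -
    have ne: "{B \<in> sets M. B \<subseteq> A} \<noteq> {}" for A by auto
    have le: "ennreal (\<sigma> C) + ennreal (\<sigma> D) \<le> p (A \<union> B)"
      if "C \<in> sets M" "C \<subseteq> A" "D \<in> sets M" "D \<subseteq> B" for C D
    proof -
      have "C \<inter> D = {}" using AB that by auto
      then have e: "\<sigma> (C \<union> D) = \<sigma> C + \<sigma> D" using that
        by (intro sums_signed_Un[OF ca]) auto
      consider "\<sigma> C \<ge> 0" "\<sigma> D \<ge> 0" | "\<sigma> C < 0" | "\<sigma> D < 0" by linarith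
      then show ?thesis
      proof cases
        case 1
        then have "ennreal (\<sigma> C) + ennreal (\<sigma> D) = ennreal (\<sigma> (C \<union> D))" by (simp add: e)
        also have "\<dots> \<le> p (A \<union> B)" using that by (intro pI) auto
        finally show ?thesis .
      next
        case 2
        then show ?thesis using pI[of D "A \<union> B"] that by (auto simp: ennreal_neg)
      next
        case 3
        then show ?thesis using pI[of C "A \<union> B"] that by (auto simp: ennreal_neg)
      qed
    qed
    have "ennreal (\<sigma> C) + p B \<le> p (A \<union> B)" if C: "C \<in> sets M" "C \<subseteq> A" for C
    proof -
      have "ennreal (\<sigma> C) + p B = (SUP D \<in> {D \<in> sets M. D \<subseteq> B}. ennreal (\<sigma> C) + ennreal (\<sigma> D))"
        unfolding p_def[of B] by (rule ennreal_SUP_add_right[OF ne])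
      also have "\<dots> \<le> p (A \<union> B)" using le C by (intro SUP_least) auto
      finally show ?thesis .
    qed
    moreover have "p A + p B = (SUP C \<in> {C \<in> sets M. C \<subseteq> A}. ennreal (\<sigma> C) + p B)"
      unfolding p_def[of A] by (rule ennreal_SUP_add_left[symmetric, OF ne])
    ultimately show ?thesis by (auto intro!: SUP_least)
  qed
  have "countably_additive (sets M) p"
  proof (rule countably_additiveI)
    fix A :: "nat \<Rightarrow> 'a set"
    assume A: "range A \<subseteq> sets M" "disjoint_family A"
    have fin: "(\<Sum>i<n. p (A i)) \<le> p (\<Union>i<n. A i)" for n
    proof (induction n)
      case (Suc n)
      have "(\<Union>i<n. A i) \<inter> A n = {}"
        using A(2) by (auto simp: disjoint_family_on_def) (metis IntI empty_iff less_irrefl)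
      then have step: "p (\<Union>i<n. A i) + p (A n) \<le> p ((\<Union>i<n. A i) \<union> A n)" by (rule padd)
      have un: "(\<Union>i<Suc n. A i) = (\<Union>i<n. A i) \<union> A n"
        by (auto simp: lessThan_Suc)
      show ?case
        unfolding un sum.lessThan_Suc by (rule order_trans[OF add_right_mono[OF Suc.IH] step])
    qed simp
    have "(\<Sum>i. p (A i)) \<le> p (\<Union>i. A i)"
    proof (rule suminf_le_const)
      show "(\<Sum>i<n. p (A i)) \<le> p (\<Union>i. A i)" for n
        using fin[of n] pmono[of "\<Union>i<n. A i" "\<Union>i. A i"] by (meson UN_mono order_trans order_refl subset_UNIV)
    qed simp
    moreover have "p (\<Union>i. A i) \<le> (\<Sum>i. p (A i))"
      unfolding p_def[of "\<Union>i. A i"]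
    proof (rule SUP_least)
      fix B assume B: "B \<in> {B \<in> sets M. B \<subseteq> (\<Union>i. A i)}"
      have "range (\<lambda>i. B \<inter> A i) \<subseteq> sets M" using A B by auto
      moreover have "disjoint_family (\<lambda>i. B \<inter> A i)"
        using A(2) unfolding disjoint_family_on_def by blast
      moreover have "(\<Union>i. B \<inter> A i) = B" using B by auto
      ultimately have "(\<lambda>i. \<sigma> (B \<inter> A i)) sums \<sigma> B" using ca[of "\<lambda>i. B \<inter> A i"] by simp
      then have "(\<lambda>n. ennreal (\<Sum>i<n. \<sigma> (B \<inter> A i))) \<longlonglongrightarrow> ennreal (\<sigma> B)"
        unfolding sums_def by (intro tendsto_ennrealI)
      moreover have "ennreal (\<Sum>i<n. \<sigma> (B \<inter> A i)) \<le> (\<Sum>i. p (A i))" for n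
      proof -
        have "ennreal (\<Sum>i<n. \<sigma> (B \<inter> A i)) \<le> ennreal (\<Sum>i<n. max 0 (\<sigma> (B \<inter> A i)))"
          by (intro ennreal_leI sum_mono) auto
        also have "\<dots> = (\<Sum>i<n. ennreal (max 0 (\<sigma> (B \<inter> A i))))" by (simp add: sum_ennreal)
        also have "\<dots> \<le> (\<Sum>i<n. p (A i))"
          using A B by (intro sum_mono) (auto simp: max_def intro!: pI)
        also have "\<dots> \<le> (\<Sum>i. p (A i))" by (intro sum_le_suminf summableI) auto
        finally show ?thesis .
      qed
      ultimately show "ennreal (\<sigma> B) \<le> (\<Sum>i. p (A i))"
        by (intro LIMSEQ_le_const2[of _ "ennreal (\<sigma> B)"]) auto
    qed
    ultimately show "(\<Sum>i. p (A i)) = p (\<Union>i. A i)" by (rule antisym)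
  qed
  moreover have "positive (sets M) p"
  proof -
    have "{B \<in> sets M. B \<subseteq> {}} = {{}}" by auto
    then show ?thesis by (simp add: positive_def p_def s0)
  qed
  ultimately have "emeasure (upper_variation M \<sigma>) X = p X"
    unfolding upper_variation_def p_def[symmetric, abs_def]
    by (intro emeasure_measure_of_sigma sets.sigma_algebra_axioms X)
  then show ?thesis by (simp add: p_def)
qed

lemma complex_measure_integral_of_finite_measure:
  assumes "finite_measure M"
  shows "complex_measure_integral M (\<lambda>A. complex_of_real (measure M A)) f = integral\<^sup>L M f"
proof -
  interpret finite_measure M by fact
  have ca: "(\<lambda>i. measure M (A i)) sums measure M (\<Union>i. A i)"
    if "range A \<subseteq> sets M" "disjoint_family A" for A :: "nat \<Rightarrow> 'a set"
    using finite_measure_UNION[OF that] .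
  have sets [simp]: "sets (upper_variation M \<sigma>) = sets M" for \<sigma>
    by (simp add: upper_variation_def)
  have pos: "upper_variation M (measure M) = M"
  proof (rule measure_eqI)
    fix X assume "X \<in> sets (upper_variation M (measure M))"
    then have X: "X \<in> sets M" by simp
    have "(SUP B \<in> {B \<in> sets M. B \<subseteq> X}. ennreal (measure M B)) = emeasure M X"
      using X by (intro antisym SUP_least SUP_upper2[of X])
                 (auto simp: emeasure_eq_measure intro: finite_measure_mono)
    then show "emeasure (upper_variation M (measure M)) X = emeasure M X"
      using emeasure_upper_variation[OF ca X] by simp
  qed simp
  have null: "upper_variation M \<sigma> = null_measure M"
    if "\<And>A. \<sigma> A \<le> 0" and "\<And>A :: nat \<Rightarrow> 'a set. range A \<subseteq> sets M \<Longrightarrow> disjoint_family A \<Longrightarrow>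
             (\<lambda>i. \<sigma> (A i)) sums \<sigma> (\<Union>i. A i)" for \<sigma>
  proof (rule measure_eqI)
    fix X assume "X \<in> sets (upper_variation M \<sigma>)"
    then have X: "X \<in> sets M" by simp
    have "{B \<in> sets M. B \<subseteq> X} \<noteq> {}" by auto
    then show "emeasure (upper_variation M \<sigma>) X = emeasure (null_measure M) X"
      using emeasure_upper_variation[OF that(2) X] that(1) by (simp add: ennreal_neg)
  qed simp
  have "upper_variation M (\<lambda>A. - measure M A) = null_measure M"
    using ca by (intro null sums_minus) auto
  moreover have "upper_variation M (\<lambda>A. 0) = null_measure M"
    by (intro null) auto
  ultimately show ?thesis
    using pos by (simp add: complex_measure_integral_def)
qed

end

theory Submission
  imports Defs "HOL-Probability.Probability" "HOL-Complex_Analysis.Complex_Analysis"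
begin

text \<open>
  The set. Fix \<open>\<delta>\<^sub>n = 2^(-n\<^sup>2) / 80\<close> and remove from \<open>[0, 1]\<close>, for every \<open>n\<close>, the open arcs of radius
  \<open>\<delta>\<^sub>n / N\<^sub>n\<close> about the multiples of \<open>1 / N\<^sub>n\<close>; equivalently, keep the \<open>x\<close> with
  \<open>cos (2\<pi> N\<^sub>n x) \<le> cos (2\<pi> \<delta>\<^sub>n)\<close>. The integers \<open>N\<^sub>n\<close> are chosen independently of
  each other, each large in terms of \<open>\<Omega>\<close>, \<open>\<delta>\<^sub>n\<close> and \<open>n\<close>.

  Uniqueness. However short an arc of the unit circle is, there is a function \<open>\<phi>(z) = \<Sum> c\<^sub>k z^k\<close> that
  is analytic beyond the closed disc, has \<open>\<phi>(0) = 1\<close>, and is tiny on the circle off the arc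
  (\<open>outer_function_small_off_arc\<close>): an analytic function may pay for smallness on most of the circle
  by being huge on the rest. Let \<open>\<phi>\<^sub>n\<close> be such a function for the \<open>n\<close>-th arc. For \<open>\<nu>\<close> carried by the set,
  the integral of \<open>exp (-i x \<xi>) \<phi>\<^sub>n (exp (-2\<pi> i N\<^sub>n x))\<close> against \<open>\<nu>\<close> is then tiny. On the other hand it
  equals \<open>\<Sum> c\<^sub>k F (\<xi> + 2\<pi> k N\<^sub>n)\<close> with \<open>F\<close> the transform of \<open>\<nu>\<close>. The term \<open>k = 0\<close> is
  \<open>F \<xi>\<close>, and since no negative \<open>k\<close> occur, all other terms sit at large positive frequencies, where the
  one-sided bound \<open>\<Omega>\<close> makes them negligible. Hence \<open>F\<close> vanishes identically, and \<open>\<nu> = 0\<close> by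
  the uniqueness theorem for characteristic functions.

  The measure. Its density is \<open>f(x) = x (1 - x) \<Prod> (1 - \<eta>\<^sub>n(N\<^sub>n x))\<close> on \<open>[0, 1]\<close>, where \<open>\<eta>\<^sub>n\<close> is a
  1-periodic trapezoid equal to 1 on the \<open>n\<close>-th arc. Its cosine coefficients have absolute sum at
  most 3 and are each at most \<open>10 \<delta>\<^sub>n\<close> (\<open>wiener_bump\<close>). Replacing \<open>x\<close> by \<open>N\<^sub>n x\<close> only spreads these
  coefficients out, so nothing below depends on \<open>N\<^sub>n\<close>. Multiplying by \<open>1 - \<eta>\<^sub>n(N\<^sub>n x)\<close> replaces the
  Fourier transform by a combination of its translates by multiples of \<open>2\<pi>\<close>. This multiplies by at
  most 4 both the \<open>L\<^sup>1\<close> norm and the supremum of the sums of the absolute values over translates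
  \<open>\<xi> + 2\<pi> \<int>\<close>; and the correction made in step \<open>n\<close> is pointwise at most \<open>10 \<delta>\<^sub>n 4^n S\<close>
  (\<open>shift_average_bounds\<close>). Here \<open>S\<close> and \<open>L\<close> are the supremum of lattice sums and the \<open>L\<^sup>1\<close> norm for the
  initial density \<open>x (1 - x)\<close>. So the \<open>r\<close>-th power of the correction has integral at most
  \<open>(10 \<delta>\<^sub>n 4^n S)^(r-1) 3 4^n L\<close>.
  As \<open>\<delta>\<^sub>n\<close> decays faster than any exponential, these bounds are summable for every \<open>r > 1\<close>.
  The mass lost in step \<open>n\<close> is at most \<open>\<integral>\<eta>\<^sub>n = 3 \<delta>\<^sub>n\<close>, so \<open>f\<close> has positive integral. As
  \<open>f \<le> 1\<close> vanishes off the set, the set has positive Lebesgue measure.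
\<close>

section \<open>Complex measures and their Fourier transforms\<close>

definition signed_measure :: "'a measure \<Rightarrow> ('a set \<Rightarrow> real) \<Rightarrow> bool" where
  "signed_measure M \<sigma> \<longleftrightarrow>
     (\<forall>A :: nat \<Rightarrow> 'a set. range A \<subseteq> sets M \<longrightarrow> disjoint_family A \<longrightarrow>
        (\<lambda>i. \<sigma> (A i)) sums \<sigma> (\<Union>i. A i))"

lemma signed_measure_empty: "signed_measure M \<sigma> \<Longrightarrow> \<sigma> {} = 0"
  by (rule sums_signed_empty[of M]) (auto simp: signed_measure_def)

lemma signed_measure_Un:
  "signed_measure M \<sigma> \<Longrightarrow> A \<in> sets M \<Longrightarrow> B \<in> sets M \<Longrightarrow> A \<inter> B = {} \<Longrightarrow> \<sigma> (A \<union> B) = \<sigma> A + \<sigma> B"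
  by (rule sums_signed_Un[of M]) (auto simp: signed_measure_def)

lemma signed_measure_uminus: "signed_measure M \<sigma> \<Longrightarrow> signed_measure M (\<lambda>A. - \<sigma> A)"
  by (simp add: signed_measure_def sums_minus)

lemma emeasure_signed_upper_variation:
  "signed_measure M \<sigma> \<Longrightarrow> X \<in> sets M \<Longrightarrow>
    emeasure (upper_variation M \<sigma>) X = (SUP B \<in> {B \<in> sets M. B \<subseteq> X}. ennreal (\<sigma> B))"
  by (rule emeasure_upper_variation) (auto simp: signed_measure_def)

text \<open>
  If the values on subsets of \<open>X\<close> were unbounded, then \<open>X\<close> would split into two pieces of value
  larger than 1 in modulus, at least one of which again has unbounded values on its subsets. Iterating
  on that piece yields disjoint sets whose values do not tend to 0, against countable additivity.
\<close>

lemma signed_measure_bounded: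
  fixes \<sigma> :: "'a set \<Rightarrow> real"
  assumes ca: "signed_measure M \<sigma>"
    and X: "X \<in> sets M"
  shows "\<exists>b. \<forall>B\<in>sets M. B \<subseteq> X \<longrightarrow> \<bar>\<sigma> B\<bar> \<le> b"
proof (rule ccontr)
  define unb where "unb X \<longleftrightarrow> (\<forall>b. \<exists>B\<in>sets M. B \<subseteq> X \<and> \<bar>\<sigma> B\<bar> > b)" for X
  assume "\<not> ?thesis"
  then have unbX: "unb X" unfolding unb_def by (meson not_le)
  have add: "\<sigma> (A \<union> B) = \<sigma> A + \<sigma> B" if "A \<in> sets M" "B \<in> sets M" "A \<inter> B = {}" for A B
    using signed_measure_Un[OF ca that] .
  have split: "\<exists>Z. (Z \<in> sets M \<and> unb Z) \<and> (Z \<subseteq> Y \<and> \<bar>\<sigma> (Y - Z)\<bar> > 1)"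
    if Y: "Y \<in> sets M \<and> unb Y" for Y
  proof -
    obtain B where B: "B \<in> sets M" "B \<subseteq> Y" "\<bar>\<sigma> B\<bar> > \<bar>\<sigma> Y\<bar> + 1"
      using Y unfolding unb_def by blast
    have "\<sigma> Y = \<sigma> B + \<sigma> (Y - B)"
      using add[of B "Y - B"] B Y by (auto simp: Un_absorb1)
    with B(3) have big: "\<bar>\<sigma> (Y - B)\<bar> > 1" by linarith
    show ?thesis
    proof (cases "unb B")
      case True
      then show ?thesis using B big by blast
    next
      case False
      then obtain b1 where b1: "\<And>C. C \<in> sets M \<Longrightarrow> C \<subseteq> B \<Longrightarrow> \<bar>\<sigma> C\<bar> \<le> b1"
        unfolding unb_def by (meson not_le)
      have "unb (Y - B)"
        unfolding unb_def
      proof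
        fix b
        obtain C where C: "C \<in> sets M" "C \<subseteq> Y" "\<bar>\<sigma> C\<bar> > b + b1"
          using Y unfolding unb_def by blast
        have "\<sigma> C = \<sigma> (C \<inter> B) + \<sigma> (C - B)"
          using add[of "C \<inter> B" "C - B"] C B by (auto simp: Int_Diff_Un)
        moreover have "\<bar>\<sigma> (C \<inter> B)\<bar> \<le> b1" using C B by (intro b1) auto
        ultimately have "\<bar>\<sigma> (C - B)\<bar> > b" using C(3) by linarith
        then show "\<exists>D\<in>sets M. D \<subseteq> Y - B \<and> b < \<bar>\<sigma> D\<bar>"
          using C B by (intro bexI[of _ "C - B"]) auto
      qed
      moreover have "Y - (Y - B) = B" using B by auto
      ultimately show ?thesis using B Y by (intro exI[of _ "Y - B"]) auto
    qed
  qed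
  have "\<exists>Xs. \<forall>n. (Xs n \<in> sets M \<and> unb (Xs n)) \<and> (Xs (Suc n) \<subseteq> Xs n \<and> \<bar>\<sigma> (Xs n - Xs (Suc n))\<bar> > 1)"
  proof (rule dependent_nat_choice[of "\<lambda>_ Y. Y \<in> sets M \<and> unb Y" "\<lambda>_ Y Z. Z \<subseteq> Y \<and> \<bar>\<sigma> (Y - Z)\<bar> > 1"])
    show "\<exists>Y. Y \<in> sets M \<and> unb Y" using X unbX by blast
  qed (rule split)
  then obtain Xs where Xs': "\<forall>n. (Xs n \<in> sets M \<and> unb (Xs n)) \<and> (Xs (Suc n) \<subseteq> Xs n \<and> \<bar>\<sigma> (Xs n - Xs (Suc n))\<bar> > 1)"
    by (rule exE)
  have Xs: "Xs n \<in> sets M \<and> unb (Xs n)"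
    and step: "Xs (Suc n) \<subseteq> Xs n \<and> \<bar>\<sigma> (Xs n - Xs (Suc n))\<bar> > 1" for n
    using spec[OF Xs', of n] by simp_all
  define A where "A n = Xs n - Xs (Suc n)" for n
  have dec: "Xs n \<subseteq> Xs m" if "m \<le> n" for m n
    by (rule lift_Suc_antimono_le[OF _ that]) (rule conjunct1[OF step])
  have "disjoint_family A"
    unfolding disjoint_family_on_def
  proof (intro ballI impI)
    fix m n :: nat assume "m \<noteq> n"
    then consider "Suc m \<le> n" | "Suc n \<le> m" by linarith
    then show "A m \<inter> A n = {}"
      using dec[of "Suc m" n] dec[of "Suc n" m] by cases (auto simp: A_def)
  qed
  moreover have "range A \<subseteq> sets M" using Xs by (auto simp: A_def)
  ultimately have "(\<lambda>i. \<sigma> (A i)) \<longlonglongrightarrow> 0"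
    using ca unfolding signed_measure_def by (blast intro: summable_LIMSEQ_zero sums_summable)
  from tendstoD[OF this, of 1] have "\<forall>\<^sub>F i in sequentially. \<bar>\<sigma> (A i)\<bar> < 1"
    by simp
  then obtain i where "\<bar>\<sigma> (A i)\<bar> < 1" using eventually_happens by force
  then show False using step[of i] by (simp add: A_def)
qed

lemma sets_upper_variation [simp]: "sets (upper_variation M \<sigma>) = sets M"
  and space_upper_variation [simp]: "space (upper_variation M \<sigma>) = space M"
  by (simp_all add: upper_variation_def)

text \<open>
  Finiteness is what makes the integral against a complex measure meaningful: the bounded function
  \<open>exp (-i x \<xi>)\<close> would not be integrable for an infinite variation, and its integral would be 0 by
  convention.
\<close>

lemma finite_measure_upper_variation:
  fixes \<sigma> :: "'a set \<Rightarrow> real"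
  assumes ca: "signed_measure M \<sigma>"
  shows "finite_measure (upper_variation M \<sigma>)"
proof
  obtain b where b: "\<And>B. B \<in> sets M \<Longrightarrow> B \<subseteq> space M \<Longrightarrow> \<bar>\<sigma> B\<bar> \<le> b"
    using signed_measure_bounded[OF ca, of "space M"] by auto
  have "emeasure (upper_variation M \<sigma>) (space M) \<le> ennreal b"
    using b by (subst emeasure_signed_upper_variation[OF ca])
      (auto intro!: SUP_least ennreal_leI intro: order_trans[OF abs_ge_self])
  then show "emeasure (upper_variation M \<sigma>) (space (upper_variation M \<sigma>)) \<noteq> \<infinity>"
    by (auto simp: top_unique)
qed

text \<open>
  For \<open>B \<subseteq> X\<close> one has \<open>\<sigma> B = \<sigma> X - \<sigma> (X - B)\<close>; taking suprema gives \<open>\<sigma>\<^sup>+ X \<le> \<sigma> X + \<sigma>\<^sup>- X\<close>, and the same for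
  \<open>-\<sigma>\<close> gives the reverse inequality.
\<close>

lemma jordan_decomposition:
  fixes \<sigma> :: "'a set \<Rightarrow> real"
  assumes ca: "signed_measure M \<sigma>"
    and X: "X \<in> sets M"
  shows "\<sigma> X = measure (upper_variation M \<sigma>) X - measure (upper_variation M (\<lambda>A. - \<sigma> A)) X"
proof -
  have le: "measure (upper_variation M \<tau>) X \<le> \<tau> X + measure (upper_variation M (\<lambda>A. - \<tau> A)) X"
    if ca: "signed_measure M \<tau>" for \<tau> :: "'a set \<Rightarrow> real"
  proof -
    have ca': "signed_measure M (\<lambda>A. - \<tau> A)"
      using ca by (rule signed_measure_uminus)
    interpret N: finite_measure "upper_variation M (\<lambda>A. - \<tau> A)"
      by (rule finite_measure_upper_variation[OF ca'])
    have up: "- \<tau> C \<le> measure (upper_variation M (\<lambda>A. - \<tau> A)) X"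
      if "C \<in> sets M" "C \<subseteq> X" for C
    proof -
      have "ennreal (- \<tau> C) \<le> emeasure (upper_variation M (\<lambda>A. - \<tau> A)) X"
        using that by (subst emeasure_signed_upper_variation[OF ca' X]) (auto intro: SUP_upper)
      then show ?thesis
        using measure_nonneg[of "upper_variation M (\<lambda>A. - \<tau> A)" X]
        by (simp add: N.emeasure_eq_measure ennreal_le_iff2) linarith
    qed
    let ?r = "\<tau> X + measure (upper_variation M (\<lambda>A. - \<tau> A)) X"
    have B: "\<tau> B \<le> ?r" if "B \<in> sets M" "B \<subseteq> X" for B
    proof -
      have "\<tau> X = \<tau> B + \<tau> (X - B)"
        using signed_measure_Un[OF ca, of B "X - B"] that X by (simp add: Un_absorb1)
      moreover have "- \<tau> (X - B) \<le> measure (upper_variation M (\<lambda>A. - \<tau> A)) X"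
        using that X by (intro up) auto
      ultimately show ?thesis by linarith
    qed
    have "emeasure (upper_variation M \<tau>) X \<le> ennreal ?r"
      by (subst emeasure_signed_upper_variation[OF ca X]) (auto intro!: SUP_least ennreal_leI B)
    moreover have "0 \<le> ?r" using B[of "{}"] signed_measure_empty[OF ca] by auto
    ultimately show ?thesis by (simp add: measure_def enn2real_leI)
  qed
  have ca': "signed_measure M (\<lambda>A. - \<sigma> A)"
      using ca by (rule signed_measure_uminus)
  show ?thesis using le[OF ca] le[OF ca'] by simp
qed

text \<open>
  Evaluation at \<open>\<xi> = 0\<close> shows that the total masses agree, so both measures can be normalised to
  probability measures with the same characteristic function.
\<close>

lemma finite_measure_eq_of_fourier:
  fixes M N :: "real measure"
  assumes "finite_measure M" "finite_measure N" and sets: "sets M = sets borel" "sets N = sets borel"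
    and eq: "\<And>\<xi>. (\<integral>x. exp (- (\<i> * complex_of_real x * complex_of_real \<xi>)) \<partial>M)
                 = (\<integral>x. exp (- (\<i> * complex_of_real x * complex_of_real \<xi>)) \<partial>N)"
  shows "measure M A = measure N A"
proof -
  interpret M: finite_measure M by fact
  interpret N: finite_measure N by fact
  have space: "space M = UNIV" "space N = UNIV"
    using sets_eq_imp_space_eq[OF sets(1)] sets_eq_imp_space_eq[OF sets(2)] by auto
  have mass: "measure M UNIV = measure N UNIV"
    using eq[of 0] by (simp add: space)
  show ?thesis
  proof (cases "measure M UNIV = 0")
    case True
    have "measure M A \<le> measure M UNIV" "measure N A \<le> measure N UNIV"
      using M.bounded_measure[of A] N.bounded_measure[of A] by (simp_all add: space)
    then show ?thesis using True mass by (metis measure_nonneg order_antisym)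
  next
    case False
    define m where "m = measure M UNIV"
    have m: "m > 0" using False by (simp add: m_def zero_less_measure_iff)
    have distr: "real_distribution (density K (\<lambda>_. ennreal (1 / m)))"
      if "finite_measure K" "sets K = sets borel" "measure K UNIV = m" for K
    proof -
      interpret finite_measure K by fact
      have sp: "space K = UNIV" using sets_eq_imp_space_eq[OF that(2)] by auto
      have "emeasure (density K (\<lambda>_. ennreal (1 / m))) UNIV = 1"
        using m that(2) emeasure_eq_measure[of UNIV]
        by (simp add: emeasure_density nn_integral_cmult_indicator that(3) sp ennreal_mult[symmetric])
      then have "prob_space (density K (\<lambda>_. ennreal (1 / m)))"
        by (intro prob_spaceI) (simp add: sp)
      then show ?thesis
        using that sp by (simp add: real_distribution_def real_distribution_axioms_def)
    qed
    have char: "char (density K (\<lambda>_. ennreal (1 / m))) t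
        = (1 / m) * (\<integral>x. exp (- (\<i> * complex_of_real x * complex_of_real (- t))) \<partial>K)"
      if "sets K = sets borel" for K t
    proof -
      have [measurable_cong]: "sets K = sets borel" by fact
      have "char (density K (\<lambda>_. ennreal (1 / m))) t = (\<integral>x. (1 / m) *\<^sub>R iexp (t * x) \<partial>K)"
        unfolding char_def using m by (subst integral_density) auto
      also have "\<dots> = (\<integral>x. (1 / m) *\<^sub>R exp (- (\<i> * complex_of_real x * complex_of_real (- t))) \<partial>K)"
        by (intro Bochner_Integration.integral_cong) (auto simp: mult_ac)
      finally show ?thesis by (simp add: scaleR_conv_of_real)
    qed
    have "char (density M (\<lambda>_. ennreal (1 / m))) = char (density N (\<lambda>_. ennreal (1 / m)))"
      by (rule ext) (simp only: char[OF sets(1)] char[OF sets(2)] eq)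
    then have "density M (\<lambda>_. ennreal (1 / m)) = density N (\<lambda>_. ennreal (1 / m))"
      using distr[OF assms(1) sets(1)] distr[OF assms(2) sets(2)] mass
      by (intro Levy_uniqueness) (auto simp: m_def)
    then have e: "emeasure (density M (\<lambda>_. ennreal (1 / m))) A
                = emeasure (density N (\<lambda>_. ennreal (1 / m))) A" by simp
    show ?thesis
    proof (cases "A \<in> sets borel")
      case True
      have "ennreal (1 / m) * emeasure M A = ennreal (1 / m) * emeasure N A"
        using e True by (simp add: emeasure_density nn_integral_cmult_indicator sets)
      then show ?thesis using m
        by (simp add: M.emeasure_eq_measure N.emeasure_eq_measure ennreal_mult[symmetric])
    next
      case False
      then show ?thesis by (simp add: measure_notin_sets sets)
    qed
  qed
qed

text \<open>
  Integrating an absolutely convergent exponential series term by term turns a bound for the series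
  on the support into a relation between values of the Fourier transform along \<open>\<xi> + s \<nat>\<close>.
\<close>

lemma fourier_synthesis_measure:
  fixes M :: "real measure" and c :: "nat \<Rightarrow> complex"
  assumes "finite_measure M" and sets: "sets M = sets borel" and AE: "AE x in M. x \<in> E"
    and c: "summable (\<lambda>k. norm (c k))"
    and small: "\<And>x. x \<in> E \<Longrightarrow> norm (\<Sum>k. c k * exp (- (\<i> * complex_of_real x * complex_of_real (real k * s)))) \<le> \<epsilon>"
  shows "\<exists>L. (\<lambda>k. c k * (\<integral>x. exp (- (\<i> * complex_of_real x * complex_of_real (\<xi> + real k * s))) \<partial>M)) sums L
            \<and> norm L \<le> \<epsilon> * measure M UNIV"
proof -
  interpret finite_measure M by fact
  have space: "space M = UNIV" using sets_eq_imp_space_eq[OF sets] by auto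
  have [measurable_cong]: "sets M = sets borel" by fact
  define f where "f k x = c k * exp (- (\<i> * complex_of_real x * complex_of_real (\<xi> + real k * s)))" for k x
  have nf: "norm (f k x) = norm (c k)" for k x
    by (simp add: f_def norm_mult)
  have [measurable]: "f k \<in> borel_measurable M" for k
    unfolding f_def by measurable
  have int: "integrable M (f k)" for k
    by (rule integrable_const_bound[of _ "norm (c k)"]) (auto simp: nf)
  have sums: "(\<lambda>k. integral\<^sup>L M (f k)) sums (\<integral>x. (\<Sum>k. f k x) \<partial>M)"
    using c by (intro sums_integral int) (auto simp: nf)
  have eq: "(\<Sum>k. f k x) = exp (- (\<i> * complex_of_real x * complex_of_real \<xi>)) *
      (\<Sum>k. c k * exp (- (\<i> * complex_of_real x * complex_of_real (real k * s))))" for x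
  proof -
    have "(\<Sum>k. f k x) = (\<Sum>k. exp (- (\<i> * complex_of_real x * complex_of_real \<xi>)) *
        (c k * exp (- (\<i> * complex_of_real x * complex_of_real (real k * s)))))"
    proof (intro suminf_cong)
      fix k
      have "exp (- (\<i> * complex_of_real x * complex_of_real (\<xi> + real k * s)))
        = exp (- (\<i> * complex_of_real x * complex_of_real \<xi>)) *
          exp (- (\<i> * complex_of_real x * complex_of_real (real k * s)))"
        unfolding exp_add[symmetric] of_real_add distrib_left minus_add_distrib ..
      then show "f k x = exp (- (\<i> * complex_of_real x * complex_of_real \<xi>)) *
        (c k * exp (- (\<i> * complex_of_real x * complex_of_real (real k * s))))"
        unfolding f_def by (simp only: mult.left_commute)
    qed
    also have "\<dots> = exp (- (\<i> * complex_of_real x * complex_of_real \<xi>)) *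
      (\<Sum>k. c k * exp (- (\<i> * complex_of_real x * complex_of_real (real k * s))))"
      by (rule suminf_mult, rule summable_norm_cancel) (simp add: norm_mult c)
    finally show ?thesis .
  qed
  have bound: "AE x in M. norm (\<Sum>k. f k x) \<le> \<epsilon>"
    using AE
  proof eventually_elim
    case (elim x)
    have "norm (exp (- (\<i> * complex_of_real x * complex_of_real \<xi>))) = 1" by simp
    then show ?case unfolding eq norm_mult by (simp only: mult_1_left small[OF elim])
  qed
  have "norm (\<integral>x. (\<Sum>k. f k x) \<partial>M) \<le> (\<integral>x. norm (\<Sum>k. f k x) \<partial>M)"
    by (rule integral_norm_bound)
  also have "\<dots> \<le> (\<integral>x. \<epsilon> \<partial>M)"
  proof (rule integral_mono_AE)
    show "integrable M (\<lambda>x. norm (\<Sum>k. f k x))"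
      using c by (intro integrable_norm integrable_suminf int) (auto simp: nf)
  qed (use bound in auto)
  also have "\<dots> = \<epsilon> * measure M UNIV" by (simp add: space)
  finally have le: "norm (\<integral>x. (\<Sum>k. f k x) \<partial>M) \<le> \<epsilon> * measure M UNIV" .
  have fk: "integral\<^sup>L M (f k)
      = c k * (\<integral>x. exp (- (\<i> * complex_of_real x * complex_of_real (\<xi> + real k * s))) \<partial>M)" for k
    unfolding f_def[abs_def] by simp
  show ?thesis unfolding fk[symmetric] using sums le by blast
qed

text \<open>
  Reduces statements on complex measures carried by \<open>E\<close> to finite positive measures: the variations of
  the real and imaginary parts are again carried by \<open>E\<close>, as every subset of the complement has value 0.
\<close>

lemma complex_measure_decomposition:
  assumes \<nu>: "\<nu> \<in> measures_supported_in E" and E: "E \<in> sets borel"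
  obtains M1 M2 M3 M4 :: "real measure" where
    "\<And>M. M \<in> {M1, M2, M3, M4} \<Longrightarrow> finite_measure M \<and> sets M = sets borel \<and> (AE x in M. x \<in> E)"
    "\<And>A. A \<in> sets borel \<Longrightarrow>
       \<nu> A = of_real (measure M1 A - measure M2 A) + \<i> * of_real (measure M3 A - measure M4 A)"
    "\<And>f. complex_measure_integral borel \<nu> f
       = (integral\<^sup>L M1 f - integral\<^sup>L M2 f) + \<i> * (integral\<^sup>L M3 f - integral\<^sup>L M4 f)"
proof -
  have caRe: "signed_measure borel (\<lambda>A. Re (\<nu> A))" and caIm: "signed_measure borel (\<lambda>A. Im (\<nu> A))"
    using \<nu> by (auto simp: measures_supported_in_def complex_measure_def signed_measure_def
        intro: sums_Re sums_Im)
  have null: "\<nu> A = 0" if "A \<in> sets borel" "A \<inter> E = {}" for A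
    using \<nu> that by (auto simp: measures_supported_in_def)
  have up: "finite_measure (upper_variation borel \<sigma>) \<and> sets (upper_variation borel \<sigma>) = sets borel \<and>
      (AE x in upper_variation borel \<sigma>. x \<in> E)"
    if ca: "signed_measure borel \<sigma>"
      and null: "\<And>A. A \<in> sets borel \<Longrightarrow> A \<inter> E = {} \<Longrightarrow> \<sigma> A = 0" for \<sigma>
  proof -
    have "ennreal (\<sigma> B) \<le> 0" if "B \<in> sets borel" "B \<subseteq> - E" for B
      using null[of B] that by (auto simp: disjoint_eq_subset_Compl)
    then have "(SUP B \<in> {B \<in> sets borel. B \<subseteq> - E}. ennreal (\<sigma> B)) \<le> 0"
      by (intro SUP_least) blast
    then have "emeasure (upper_variation borel \<sigma>) (- E) = 0"
      using emeasure_signed_upper_variation[OF ca, of "- E"] E by simp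
    then have "AE x in upper_variation borel \<sigma>. x \<in> E"
      using E by (intro AE_I[of _ _ "- E"]) auto
    then show ?thesis using finite_measure_upper_variation[OF ca] by simp
  qed
  show ?thesis
  proof (rule that)
    fix M assume M: "M \<in> {upper_variation borel (\<lambda>A. Re (\<nu> A)), upper_variation borel (\<lambda>A. - Re (\<nu> A)),
        upper_variation borel (\<lambda>A. Im (\<nu> A)), upper_variation borel (\<lambda>A. - Im (\<nu> A))}"
    have "signed_measure borel (\<lambda>A. - Re (\<nu> A))" "signed_measure borel (\<lambda>A. - Im (\<nu> A))"
      by (rule signed_measure_uminus, rule caRe, rule signed_measure_uminus, rule caIm)
    note up4 = up[OF caRe] up[OF this(1)] up[OF caIm] up[OF this(2)]
    show "finite_measure M \<and> sets M = sets borel \<and> (AE x in M. x \<in> E)"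
      using M unfolding insert_iff empty_iff
      by (elim disjE FalseE; hypsubst, intro up4) (simp_all add: null)
  next
    fix A :: "real set" assume A: "A \<in> sets borel"
    show "\<nu> A = of_real (measure (upper_variation borel (\<lambda>A. Re (\<nu> A))) A
            - measure (upper_variation borel (\<lambda>A. - Re (\<nu> A))) A)
        + \<i> * of_real (measure (upper_variation borel (\<lambda>A. Im (\<nu> A))) A
            - measure (upper_variation borel (\<lambda>A. - Im (\<nu> A))) A)"
      using jordan_decomposition[OF caRe A] jordan_decomposition[OF caIm A]
      by (simp add: complex_eq_iff)
  qed (simp add: complex_measure_integral_def)
qed

text \<open>
  Here \<open>V\<close> bounds the total variation of \<open>\<nu>\<close>; it must not depend on the series, because the uniqueness
  argument lets \<open>\<epsilon>\<close> tend to 0.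
\<close>

lemma fourier_synthesis:
  assumes \<nu>: "\<nu> \<in> measures_supported_in E" and E: "E \<in> sets borel"
  shows "\<exists>V. \<forall>c s \<epsilon> \<xi>. summable (\<lambda>k. norm (c k)) \<longrightarrow>
      (\<forall>x\<in>E. norm (\<Sum>k. c k * exp (- (\<i> * complex_of_real x * complex_of_real (real k * s)))) \<le> \<epsilon>) \<longrightarrow>
      (\<exists>L. (\<lambda>k. c k * fourier_transform \<nu> (\<xi> + real k * s)) sums L \<and> norm L \<le> \<epsilon> * V)"
proof -
  obtain M1 M2 M3 M4 :: "real measure" where
    M: "\<And>M. M \<in> {M1, M2, M3, M4} \<Longrightarrow> finite_measure M \<and> sets M = sets borel \<and> (AE x in M. x \<in> E)"
    and "\<And>A. A \<in> sets borel \<Longrightarrow>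
       \<nu> A = of_real (measure M1 A - measure M2 A) + \<i> * of_real (measure M3 A - measure M4 A)"
    and int: "\<And>f. complex_measure_integral borel \<nu> f
       = (integral\<^sup>L M1 f - integral\<^sup>L M2 f) + \<i> * (integral\<^sup>L M3 f - integral\<^sup>L M4 f)"
    by (rule complex_measure_decomposition[OF \<nu> E]) (rule that)
  show ?thesis
  proof (rule exI, intro allI impI)
    fix c :: "nat \<Rightarrow> complex" and s \<epsilon> \<xi> :: real
    assume c: "summable (\<lambda>k. norm (c k))"
      and "\<forall>x\<in>E. norm (\<Sum>k. c k * exp (- (\<i> * complex_of_real x * complex_of_real (real k * s)))) \<le> \<epsilon>"
    then have small: "x \<in> E \<Longrightarrow>
        norm (\<Sum>k. c k * exp (- (\<i> * complex_of_real x * complex_of_real (real k * s)))) \<le> \<epsilon>" for x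
      by blast
    define I where "I N k = c k * (\<integral>x. exp (- (\<i> * complex_of_real x * complex_of_real (\<xi> + real k * s))) \<partial>N)" for N k
    have "\<exists>L. I N sums L \<and> norm L \<le> \<epsilon> * measure N UNIV" if "N \<in> {M1, M2, M3, M4}" for N
      unfolding I_def using M[OF that] by (intro fourier_synthesis_measure[OF _ _ _ c small]) auto
    then obtain L where L: "\<And>N. N \<in> {M1, M2, M3, M4} \<Longrightarrow> I N sums L N"
      and nL: "\<And>N. N \<in> {M1, M2, M3, M4} \<Longrightarrow> norm (L N) \<le> \<epsilon> * measure N UNIV" by metis
    have ft: "c k * fourier_transform \<nu> (\<xi> + real k * s) = (I M1 k - I M2 k) + \<i> * (I M3 k - I M4 k)" for k
      unfolding fourier_transform_def int I_def by (simp add: algebra_simps)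
    have "(\<lambda>k. c k * fourier_transform \<nu> (\<xi> + real k * s)) sums ((L M1 - L M2) + \<i> * (L M3 - L M4))"
      unfolding ft by (intro sums_add sums_diff sums_mult L) auto
    moreover have "norm ((L M1 - L M2) + \<i> * (L M3 - L M4)) \<le> norm (L M1) + norm (L M2) + (norm (L M3) + norm (L M4))"
      by (rule order_trans[OF norm_triangle_ineq], rule add_mono)
         (simp_all add: norm_mult norm_triangle_ineq4)
    moreover have "\<dots> \<le> \<epsilon> * (measure M1 UNIV + measure M2 UNIV + measure M3 UNIV + measure M4 UNIV)"
      using nL[of M1] nL[of M2] nL[of M3] nL[of M4] by (simp add: distrib_left)
    ultimately show "\<exists>L. (\<lambda>k. c k * fourier_transform \<nu> (\<xi> + real k * s)) sums L \<and>
        norm L \<le> \<epsilon> * (measure M1 UNIV + measure M2 UNIV + measure M3 UNIV + measure M4 UNIV)"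
      by (meson order_trans)
  qed
qed

text \<open>
  The transforms of the real and imaginary parts of \<open>\<nu>\<close> can be separated, because each of them takes
  conjugate values at \<open>\<xi>\<close> and \<open>-\<xi>\<close>.
\<close>

lemma complex_measure_zero_of_fourier_zero:
  assumes \<nu>: "\<nu> \<in> measures_supported_in E" and E: "E \<in> sets borel"
    and zero: "\<And>\<xi>. fourier_transform \<nu> \<xi> = 0" and A: "A \<in> sets borel"
  shows "\<nu> A = 0"
proof -
  obtain M1 M2 M3 M4 :: "real measure" where
    M: "\<And>M. M \<in> {M1, M2, M3, M4} \<Longrightarrow> finite_measure M \<and> sets M = sets borel \<and> (AE x in M. x \<in> E)"
    and rep: "\<And>A. A \<in> sets borel \<Longrightarrow>
       \<nu> A = of_real (measure M1 A - measure M2 A) + \<i> * of_real (measure M3 A - measure M4 A)"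
    and int: "\<And>f. complex_measure_integral borel \<nu> f
       = (integral\<^sup>L M1 f - integral\<^sup>L M2 f) + \<i> * (integral\<^sup>L M3 f - integral\<^sup>L M4 f)"
    by (rule complex_measure_decomposition[OF \<nu> E]) (rule that)
  define e where "e \<xi> x = exp (- (\<i> * complex_of_real x * complex_of_real \<xi>))" for \<xi> x
  have cnj: "cnj (integral\<^sup>L N (e \<xi>)) = integral\<^sup>L N (e (- \<xi>))" for N \<xi>
    by (subst Bochner_Integration.integral_cnj[symmetric]) (simp add: e_def[abs_def] exp_cnj)
  have eqs: "integral\<^sup>L M1 (e \<xi>) = integral\<^sup>L M2 (e \<xi>) \<and> integral\<^sup>L M3 (e \<xi>) = integral\<^sup>L M4 (e \<xi>)" for \<xi>
  proof -
    define a where "a = integral\<^sup>L M1 (e \<xi>) - integral\<^sup>L M2 (e \<xi>)"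
    define b where "b = integral\<^sup>L M3 (e \<xi>) - integral\<^sup>L M4 (e \<xi>)"
    have "a + \<i> * b = 0"
      using zero[of \<xi>] unfolding fourier_transform_def int a_def b_def e_def .
    moreover have "cnj a + \<i> * cnj b = 0"
      using zero[of "- \<xi>"] 
      unfolding fourier_transform_def int a_def b_def complex_cnj_diff cnj unfolding e_def[abs_def] .
    then have "cnj (cnj a + \<i> * cnj b) = 0" by (simp only: complex_cnj_zero)
    then have "a - \<i> * b = 0" by simp
    ultimately have "a = 0" "b = 0" by (auto simp: complex_eq_iff)
    then show ?thesis by (simp add: a_def b_def)
  qed
  have "measure M1 A = measure M2 A" "measure M3 A = measure M4 A"
    using M[of M1] M[of M2] M[of M3] M[of M4] eqs unfolding e_def[abs_def]
    by (simp_all add: finite_measure_eq_of_fourier)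
  then show ?thesis using rep[OF A] by simp
qed

section \<open>Analytic functions that are small off an arc\<close>

text \<open>
  With \<open>P(z) = (1 + \<rho>z) / (1 - \<rho>z)\<close>, whose real part on the circle is the Poisson kernel, the function
  is \<open>\<phi> = exp (A (P - 1))\<close>. It equals 1 at the origin and is analytic in \<open>|z| < 1 / \<rho>\<close>, so its power series
  converges absolutely on the circle. For \<open>\<rho>\<close> near 1 the Poisson kernel is at most \<open>1/2\<close> outside the arc
  \<open>Re w > a\<close>, and there \<open>|\<phi>| \<le> exp (-A / 2)\<close>, which is as small as desired for large \<open>A\<close>.
\<close>

lemma outer_function_small_off_arc:
  fixes a \<epsilon> :: real
  assumes a: "a < 1" and \<epsilon>: "\<epsilon> > 0"
  obtains c :: "nat \<Rightarrow> complex" where "summable (\<lambda>k. norm (c k))" "c 0 = 1"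
    "\<And>w. norm w = 1 \<Longrightarrow> Re w \<le> a \<Longrightarrow> norm (\<Sum>k. c k * w ^ k) \<le> \<epsilon>"
proof -
  \<comment> \<open>For \<open>Re w \<le> a\<close>, positivity of this expression says that the Poisson kernel is below \<open>1/2\<close> at \<open>w\<close>.\<close>
  have "((\<lambda>\<rho>. 3 * \<rho>\<^sup>2 - 1 - 2 * \<rho> * a) \<longlongrightarrow> 3 * 1\<^sup>2 - 1 - 2 * 1 * a) (at_left 1)"
    by (intro tendsto_intros)
  then have "\<forall>\<^sub>F \<rho> in at_left 1. 0 < 3 * \<rho>\<^sup>2 - 1 - 2 * \<rho> * a"
    by (rule order_tendstoD) (use a in simp)
  moreover have "\<forall>\<^sub>F \<rho> in at_left 1. \<rho> \<in> {0<..<1::real}"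
    by (rule eventually_at_left_real) simp
  ultimately have "\<forall>\<^sub>F \<rho> in at_left 1. 0 < 3 * \<rho>\<^sup>2 - 1 - 2 * \<rho> * a \<and> \<rho> \<in> {0<..<1}"
    by eventually_elim simp
  then obtain \<rho> :: real where \<rho>: "0 < \<rho>" "\<rho> < 1" and \<rho>a: "0 < 3 * \<rho>\<^sup>2 - 1 - 2 * \<rho> * a"
    using eventually_happens[of _ "at_left (1::real)"] by (auto simp: trivial_limit_at_left_real)
  \<comment> \<open>Chosen such that \<open>exp (-A / 2) \<le> \<epsilon>\<close>.\<close>
  define A where "A = max 0 (- 2 * ln \<epsilon>)"
  \<comment> \<open>The exponent is \<open>A (P(z) - 1)\<close>.\<close>
  define \<phi> where "\<phi> z = exp (complex_of_real A * (2 * \<rho> * z / (1 - \<rho> * z)))" for z :: complex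
  define c where "c n = (deriv ^^ n) \<phi> 0 / fact n" for n
  have nz: "1 - \<rho> * z \<noteq> 0" if "norm z < 1 / \<rho>" for z :: complex
  proof
    assume "1 - \<rho> * z = 0"
    then have "norm (\<rho> * z) = 1" by (metis eq_iff_diff_eq_0 norm_one)
    then have "\<rho> * norm z = 1" using \<rho> by (simp add: norm_mult)
    then show False using that \<rho> by (simp add: field_simps)
  qed
  have hol: "\<phi> holomorphic_on ball 0 (1 / \<rho>)"
    unfolding \<phi>_def using nz by (intro holomorphic_intros) auto
  have sums: "(\<lambda>n. c n * z ^ n) sums \<phi> z" if "norm z < 1 / \<rho>" for z
    using holomorphic_power_series[OF hol, of z] that by (simp add: c_def)
  have one: "1 < 1 / \<rho>" using \<rho> by simp
  show ?thesis
  proof (rule that)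
    obtain K where K: "1 < K" "K < 1 / \<rho>" using dense[OF one] by blast
    have "summable (\<lambda>n. norm (c n * 1 ^ n))"
      using sums[of "of_real K"] K by (intro powser_insidea[of c "of_real K"]) (auto simp: sums_iff)
    then show "summable (\<lambda>k. norm (c k))" by simp
    show "c 0 = 1" by (simp add: c_def \<phi>_def)
  next
    fix w :: complex assume w: "norm w = 1" "Re w \<le> a"
    have w2: "(Re w)\<^sup>2 + (Im w)\<^sup>2 = 1" using w(1) by (metis cmod_power2 one_power2)
    define D where "D = (1 - \<rho> * Re w)\<^sup>2 + (\<rho> * Im w)\<^sup>2"
    have D': "D = 1 + \<rho>\<^sup>2 - 2 * \<rho> * Re w"
    proof -
      have "D = 1 - 2 * \<rho> * Re w + \<rho>\<^sup>2 * ((Re w)\<^sup>2 + (Im w)\<^sup>2)"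
        by (simp add: D_def power2_eq_square algebra_simps)
      then show ?thesis by (simp add: w2)
    qed
    have "D \<noteq> 0"
      using nz[of w] w(1) one by (auto simp: D_def complex_eq_iff sum_power2_eq_zero_iff)
    then have D: "D > 0" unfolding D_def by (simp add: less_le)
    have "Re (2 * \<rho> * w / (1 - \<rho> * w)) = (2 * \<rho> * Re w * (1 - \<rho> * Re w) - 2 * \<rho> * Im w * (\<rho> * Im w)) / D"
      by (simp add: Re_divide D_def)
    also have "2 * \<rho> * Re w * (1 - \<rho> * Re w) - 2 * \<rho> * Im w * (\<rho> * Im w)
        = 2 * \<rho> * Re w - 2 * \<rho>\<^sup>2 * ((Re w)\<^sup>2 + (Im w)\<^sup>2)"
      by (simp add: power2_eq_square algebra_simps)
    also have "\<dots> = 2 * \<rho> * Re w - 2 * \<rho>\<^sup>2" by (simp add: w2)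
    also have "(2 * \<rho> * Re w - 2 * \<rho>\<^sup>2) / D \<le> - 1 / 2"
    proof -
      have "\<rho> * Re w \<le> \<rho> * a" using w(2) \<rho> by (intro mult_left_mono) auto
      then have "2 * (2 * \<rho> * Re w - 2 * \<rho>\<^sup>2) \<le> - D"
        using \<rho>a unfolding D' by simp
      then show ?thesis using D by (simp add: field_simps)
    qed
    finally have "A * Re (2 * \<rho> * w / (1 - \<rho> * w)) \<le> A * (- 1 / 2)"
      by (intro mult_left_mono) (auto simp: A_def)
    also have "\<dots> \<le> ln \<epsilon>" by (simp add: A_def max_def)
    finally have "exp (A * Re (2 * \<rho> * w / (1 - \<rho> * w))) \<le> \<epsilon>"
      using \<epsilon> by (metis exp_le_cancel_iff exp_ln)
    then have "norm (\<phi> w) \<le> \<epsilon>" by (simp add: \<phi>_def norm_exp_eq_Re flip: times_divide_eq_right)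
    then show "norm (\<Sum>k. c k * w ^ k) \<le> \<epsilon>"
      using sums[of w] w(1) one by (simp add: sums_iff)
  qed
qed

section \<open>Trapezoids with absolutely summable Fourier coefficients\<close>

text \<open>
  Polar form: \<open>1 - exp (i t) = 2 sin (t / 2) exp (i (t - \<pi>) / 2)\<close>.
\<close>

lemma Ln_one_minus_cis:
  assumes "0 < t" "t < 2 * pi"
  shows "Ln (1 - cis t) = Complex (ln (2 * sin (t / 2))) ((t - pi) / 2)"
proof (rule Ln_unique)
  have s: "sin (t / 2) > 0" using assms by (intro sin_gt_zero) auto
  have c: "cos ((t - pi) / 2) = sin (t / 2)" "sin ((t - pi) / 2) = - cos (t / 2)"
    by (simp_all add: diff_divide_distrib cos_diff sin_diff)
  have "cos t = 1 - 2 * (sin (t / 2))\<^sup>2" "sin t = 2 * sin (t / 2) * cos (t / 2)"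
    using cos_double_sin[of "t / 2"] sin_double[of "t / 2"] by simp_all
  then show "exp (Complex (ln (2 * sin (t / 2))) ((t - pi) / 2)) = 1 - cis t"
    using s by (simp add: complex_eq_iff Re_exp Im_exp c power2_eq_square)
qed (use assms in auto)

text \<open>
  Termwise differentiation produces the imaginary part of the logarithmic series. It is legitimate
  only for \<open>\<rho> < 1\<close>; the next lemma passes to the limit.
\<close>

lemma cos_series_derivative:
  fixes \<rho> t :: real
  assumes \<rho>: "0 \<le> \<rho>" "\<rho> < 1"
  shows "((\<lambda>t. \<Sum>n. \<rho> ^ n * cos (real n * t) / (real n)\<^sup>2) has_real_derivative Im (Ln (1 - \<rho> * cis t))) (at t)"
proof -
  have bound: "norm (- (\<rho> ^ n * sin (real n * t) / real n)) \<le> \<rho> ^ n" for n :: nat and t :: real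
  proof (cases "n = 0")
    case False
    have "\<rho> ^ n * (\<bar>sin (real n * t)\<bar> / real n) \<le> \<rho> ^ n * 1"
    proof (intro mult_left_mono)
      show "\<bar>sin (real n * t)\<bar> / real n \<le> 1"
        using False order_trans[OF abs_sin_le_one[of "real n * t"], of "real n"] by simp
    qed (use \<rho> in auto)
    then show ?thesis using \<rho> by (simp add: abs_mult)
  qed simp
  have sm: "summable (\<lambda>n. \<rho> ^ n)" using \<rho> by (intro summable_geometric) auto
  have "((\<lambda>t. \<Sum>n. \<rho> ^ n * cos (real n * t) / (real n)\<^sup>2) has_real_derivative (\<Sum>n. - (\<rho> ^ n * sin (real n * t) / real n))) (at t)"
  proof (rule has_field_derivative_series'(2)[of UNIV _ _ 0])
    show "((\<lambda>t. \<rho> ^ n * cos (real n * t) / (real n)\<^sup>2) has_real_derivative - (\<rho> ^ n * sin (real n * t) / real n)) (at t within UNIV)"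
      for n :: nat and t :: real
      by (cases "n = 0") (auto intro!: derivative_eq_intros simp: power2_eq_square)
    show "uniformly_convergent_on UNIV (\<lambda>n t. \<Sum>i<n. - (\<rho> ^ i * sin (real i * t) / real i))"
      by (rule Weierstrass_m_test'[OF bound sm])
    show "summable (\<lambda>n. \<rho> ^ n * cos (real n * 0) / (real n)\<^sup>2)"
    proof (rule summable_comparison_test'[OF sm])
      fix n :: nat
      have "\<rho> ^ n / (real n)\<^sup>2 \<le> \<rho> ^ n" if "n \<noteq> 0"
        using that \<rho> mult_left_mono[of 1 "(real n)\<^sup>2" "\<rho> ^ n"] by (simp add: divide_le_eq)
      then show "norm (\<rho> ^ n * cos (real n * 0) / (real n)\<^sup>2) \<le> \<rho> ^ n"
        using \<rho> by (cases "n = 0") auto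
    qed
  qed auto
  also have "(\<Sum>n. - (\<rho> ^ n * sin (real n * t) / real n)) = Im (Ln (1 - \<rho> * cis t))"
  proof -
    have "norm (- (\<rho> * cis t)) < 1" using \<rho> by (simp add: norm_mult)
    from sums_Im[OF Ln_series'[OF this]]
    have "(\<lambda>n. Im (- ((\<rho> * cis t) ^ n) / of_nat n)) sums Im (Ln (1 - \<rho> * cis t))" by simp
    moreover have "Im (- ((\<rho> * cis t) ^ n) / of_nat n) = - (\<rho> ^ n * sin (real n * t) / real n)" for n
    proof -
      have "(\<rho> * cis t) ^ n = of_real (\<rho> ^ n) * cis (real n * t)"
        by (simp only: power_mult_distrib Complex.DeMoivre of_real_power)
      then show ?thesis by (simp add: Im_divide_of_nat del: of_real_power)
    qed
    ultimately have "(\<lambda>n. - (\<rho> ^ n * sin (real n * t) / real n)) sums Im (Ln (1 - \<rho> * cis t))"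
      by (simp only:)
    then show ?thesis by (rule sums_unique[symmetric])
  qed
  finally show ?thesis .
qed

text \<open>
  The Fourier series of the second Bernoulli polynomial. Abel summation: integrate the derivative of
  the series damped by \<open>\<rho>^n\<close> over \<open>[0, x]\<close> and let \<open>\<rho> \<rightarrow> 1\<close>. The derivative converges to
  \<open>(t - \<pi>) / 2\<close> and stays below \<open>\<pi>\<close>, and the value at 0 is the sum of the inverse squares.
\<close>

lemma cos_series_inverse_squares:
  assumes x: "0 \<le> x" "x \<le> 2 * pi"
  shows "(\<lambda>n. cos (real n * x) / (real n)\<^sup>2) sums (pi\<^sup>2 / 6 - pi * x / 2 + x\<^sup>2 / 4)"
proof -
  define r where "r k = 1 - 1 / real (Suc k)" for k
  define H where "H \<rho> t = (\<Sum>n. \<rho> ^ n * cos (real n * t) / (real n)\<^sup>2)" for \<rho> t :: real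
  have r: "0 \<le> r k" "r k < 1" for k by (auto simp: r_def divide_le_eq)
  have rlim: "r \<longlonglongrightarrow> 1"
    unfolding r_def by real_asymp
  have sq: "summable (\<lambda>n. 1 / (real n)\<^sup>2)"
    using inverse_squares_sums by (subst summable_Suc_iff[symmetric]) (auto simp: sums_iff add.commute)
  have Hlim: "(\<lambda>k. H (r k) t) \<longlonglongrightarrow> H 1 t" for t
  proof -
    have "(\<lambda>k. \<Sum>n. r k ^ n * cos (real n * t) / (real n)\<^sup>2) \<longlonglongrightarrow> (\<Sum>n. 1 ^ n * cos (real n * t) / (real n)\<^sup>2)"
    proof (rule conjunct2[OF conjunct2[OF tannerys_theorem]])
      show "(\<lambda>k. r k ^ n * cos (real n * t) / (real n)\<^sup>2) \<longlonglongrightarrow> 1 ^ n * cos (real n * t) / (real n)\<^sup>2" for n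
        unfolding divide_inverse by (intro tendsto_mult tendsto_power rlim tendsto_const)
      have "norm (r k ^ n * cos (real n * t) / (real n)\<^sup>2) \<le> 1 / (real n)\<^sup>2" for n k
      proof -
        have "\<bar>r k ^ n * cos (real n * t)\<bar> \<le> 1 * 1"
          unfolding abs_mult using r[of k] by (intro mult_mono) (auto intro: power_le_one less_imp_le)
        then show ?thesis by (simp add: divide_right_mono)
      qed
      then show "\<forall>\<^sub>F (n, k) in sequentially \<times>\<^sub>F sequentially. norm (r k ^ n * cos (real n * t) / (real n)\<^sup>2) \<le> 1 / (real n)\<^sup>2"
        by (auto intro!: always_eventually)
    qed (use sq in auto)
    then show ?thesis by (simp add: H_def)
  qed
  have int: "((\<lambda>t. Im (Ln (1 - r k * cis t))) has_integral (H (r k) x - H (r k) 0)) {0<..<x}" for k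
  proof -
    have "((\<lambda>t. Im (Ln (1 - r k * cis t))) has_integral (H (r k) x - H (r k) 0)) {0..x}"
      using cos_series_derivative[OF r, of k] x unfolding H_def
      by (intro fundamental_theorem_of_calculus)
         (auto simp: has_real_derivative_iff_has_vector_derivative[symmetric] intro: has_field_derivative_at_within)
    then show ?thesis by (simp add: has_integral_Icc_iff_Ioo)
  qed
  have lim: "((\<lambda>t. (t - pi) / 2) has_integral (H 1 x - H 1 0)) {0<..<x}"
  proof (rule has_integral_dominated_convergence[OF int, where h = "\<lambda>_. pi"])
    show "(\<lambda>_. pi) integrable_on {0<..<x}" using integrable_const_ivl[of pi 0 x] by (simp add: integrable_on_Icc_iff_Ioo)
    show "\<forall>t\<in>{0<..<x}. norm (Im (Ln (1 - r k * cis t))) \<le> pi" for k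
    proof
      fix t
      have "r k * cos t \<le> r k * 1" using r[of k] by (intro mult_left_mono) auto
      then have "Re (1 - r k * cis t) > 0" using r[of k] by simp
      then have "1 - r k * cis t \<noteq> 0" by (metis less_irrefl zero_complex.sel(1))
      then show "norm (Im (Ln (1 - r k * cis t))) \<le> pi"
        using Im_Ln_le_pi[of "1 - r k * cis t"] mpi_less_Im_Ln[of "1 - r k * cis t"] by simp
    qed
    show "\<forall>t\<in>{0<..<x}. (\<lambda>k. Im (Ln (1 - r k * cis t))) \<longlonglongrightarrow> (t - pi) / 2"
    proof
      fix t assume t: "t \<in> {0<..<x}"
      then have t': "0 < t" "t < 2 * pi" using x by auto
      have "sin (t / 2) > 0" using t' by (intro sin_gt_zero) auto
      then have "cos t < 1" using cos_double_sin[of "t / 2"] by simp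
      then have "1 - cis t \<notin> \<real>\<^sub>\<le>\<^sub>0" by (auto simp: complex_nonpos_Reals_iff)
      then have "(\<lambda>k. Im (Ln (1 - of_real (r k) * cis t))) \<longlonglongrightarrow> Im (Ln (1 - of_real 1 * cis t))"
        using rlim by (intro tendsto_intros) auto
      then show "(\<lambda>k. Im (Ln (1 - r k * cis t))) \<longlonglongrightarrow> (t - pi) / 2"
        using Ln_one_minus_cis[OF t'] by simp
    qed
    show "(\<lambda>k. H (r k) x - H (r k) 0) \<longlonglongrightarrow> H 1 x - H 1 0"
      by (intro tendsto_diff Hlim)
  qed
  \<comment> \<open>The same integral by the fundamental theorem; comparison gives the value of the series.\<close>
  have "((\<lambda>t. (t - pi) / 2) has_integral ((x\<^sup>2 / 4 - pi * x / 2) - (0\<^sup>2 / 4 - pi * 0 / 2))) {0..x}"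
    using x by (intro fundamental_theorem_of_calculus)
      (auto simp: has_real_derivative_iff_has_vector_derivative[symmetric] diff_divide_distrib
            intro!: derivative_eq_intros)
  then have "((\<lambda>t. (t - pi) / 2) has_integral ((x\<^sup>2 / 4 - pi * x / 2) - (0\<^sup>2 / 4 - pi * 0 / 2))) {0<..<x}"
    by (simp only: has_integral_Icc_iff_Ioo)
  from has_integral_unique[OF lim this] have "H 1 x - H 1 0 = x\<^sup>2 / 4 - pi * x / 2" by simp
  moreover have "(\<lambda>n. 1 / (real n)\<^sup>2) sums (pi\<^sup>2 / 6)"
    using sums_Suc_iff[of "\<lambda>n. 1 / (real n)\<^sup>2" "pi\<^sup>2 / 6"] inverse_squares_sums by (simp add: add.commute)
  then have "H 1 0 = pi\<^sup>2 / 6" by (simp add: H_def sums_iff)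
  moreover have "summable (\<lambda>n. cos (real n * x) / (real n)\<^sup>2)"
    by (rule summable_comparison_test'[OF sq]) (auto intro: divide_right_mono)
  then have "(\<lambda>n. cos (real n * x) / (real n)\<^sup>2) sums H 1 x"
    unfolding H_def by (simp add: summable_sums)
  moreover have "pi\<^sup>2 / 6 - pi * x / 2 + x\<^sup>2 / 4 = H 1 x"
    using calculation(1,2) by linarith
  ultimately show ?thesis by (simp only:)
qed

text \<open>
  Cosine coefficients of the 1-periodic triangle of height 1 supported on \<open>[-\<delta>, \<delta>]\<close>.
\<close>

definition triangle_coeff :: "real \<Rightarrow> nat \<Rightarrow> real" where
  "triangle_coeff \<delta> n = (if n = 0 then \<delta> else (1 - cos (2 * pi * n * \<delta>)) / (pi\<^sup>2 * n\<^sup>2 * \<delta>))"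

text \<open>
  The triangle is, up to a constant, a second difference with step \<open>\<delta>\<close> of \<open>y\<^sup>2 - |y|\<close>, whose series is
  known; \<open>2 cos a - cos (a + b) - cos (a - b) = 2 cos a (1 - cos b)\<close> identifies the coefficients.
\<close>

lemma triangle_series:
  assumes \<delta>: "0 < \<delta>" "\<delta> \<le> 1 / 2" and x: "\<bar>x\<bar> \<le> 1 / 2"
  shows "(\<lambda>n. triangle_coeff \<delta> n * cos (2 * pi * n * x)) sums max 0 (1 - \<bar>x\<bar> / \<delta>)"
proof -
  have B: "(\<lambda>n. cos (2 * pi * n * y) / (real n)\<^sup>2) sums (pi\<^sup>2 * (y\<^sup>2 - \<bar>y\<bar> + 1 / 6))" if "\<bar>y\<bar> \<le> 1" for y
  proof -
    have "(\<lambda>n. cos (real n * (2 * pi * \<bar>y\<bar>)) / (real n)\<^sup>2) sums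
        (pi\<^sup>2 / 6 - pi * (2 * pi * \<bar>y\<bar>) / 2 + (2 * pi * \<bar>y\<bar>)\<^sup>2 / 4)"
      using that by (intro cos_series_inverse_squares) (auto simp: mult_le_one)
    moreover have "cos (real n * (2 * pi * \<bar>y\<bar>)) = cos (2 * pi * n * y)" for n
      by (cases "y \<ge> 0") (simp_all add: mult_ac)
    moreover have "pi\<^sup>2 / 6 - pi * (2 * pi * \<bar>y\<bar>) / 2 + (2 * pi * \<bar>y\<bar>)\<^sup>2 / 4 = pi\<^sup>2 * (y\<^sup>2 - \<bar>y\<bar> + 1 / 6)"
      by (simp add: power2_eq_square algebra_simps)
    ultimately show ?thesis by simp
  qed
  let ?c = "\<lambda>y n. cos (2 * pi * real n * y) / (real n)\<^sup>2"
  let ?b = "\<lambda>y. pi\<^sup>2 * (y\<^sup>2 - \<bar>y\<bar> + 1 / 6)"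
  have "(\<lambda>n. (if n = 0 then \<delta> else 0) + 1 / (pi\<^sup>2 * \<delta>) * (?c x n - (?c (x + \<delta>) n + ?c (x - \<delta>) n) / 2)) sums
      (\<delta> + 1 / (pi\<^sup>2 * \<delta>) * (?b x - (?b (x + \<delta>) + ?b (x - \<delta>)) / 2))"
  proof (intro sums_add sums_mult sums_diff sums_divide B)
    show "(\<lambda>n. if n = 0 then \<delta> else 0) sums \<delta>" using sums_single[of 0 "\<lambda>_. \<delta>"] by simp
  qed (use \<delta> x in auto)
  moreover have "(if n = 0 then \<delta> else 0) + 1 / (pi\<^sup>2 * \<delta>) * (?c x n - (?c (x + \<delta>) n + ?c (x - \<delta>) n) / 2)
      = triangle_coeff \<delta> n * cos (2 * pi * n * x)" for n
  proof (cases "n = 0")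
    case False
    have "?c (x + \<delta>) n + ?c (x - \<delta>) n = 2 * cos (2 * pi * n * x) * cos (2 * pi * n * \<delta>) / (real n)\<^sup>2"
      by (simp add: distrib_left right_diff_distrib cos_add cos_diff add_divide_distrib[symmetric])
    then show ?thesis using False \<delta> by (simp add: triangle_coeff_def divide_simps) (simp add: algebra_simps)
  qed (use \<delta> in \<open>simp add: triangle_coeff_def\<close>)
  moreover have "\<delta> + 1 / (pi\<^sup>2 * \<delta>) * (?b x - (?b (x + \<delta>) + ?b (x - \<delta>)) / 2) = max 0 (1 - \<bar>x\<bar> / \<delta>)"
  proof -
    have "?b x - (?b (x + \<delta>) + ?b (x - \<delta>)) / 2 = pi\<^sup>2 * ((\<bar>x + \<delta>\<bar> + \<bar>x - \<delta>\<bar>) / 2 - \<bar>x\<bar> - \<delta>\<^sup>2)"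
    proof -
      have "P * (u - A + 1 / 6) - (P * (v - B + 1 / 6) + P * (w - C + 1 / 6)) / 2
          = P * ((B + C) / 2 - A - ((v + w) / 2 - u))" for P u v w A B C :: real
        by (simp add: field_simps)
      moreover have "((x + \<delta>)\<^sup>2 + (x - \<delta>)\<^sup>2) / 2 - x\<^sup>2 = \<delta>\<^sup>2"
        by (simp add: power2_eq_square field_simps)
      ultimately show ?thesis by simp
    qed
    then have "\<delta> + 1 / (pi\<^sup>2 * \<delta>) * (?b x - (?b (x + \<delta>) + ?b (x - \<delta>)) / 2)
      = ((\<bar>x + \<delta>\<bar> + \<bar>x - \<delta>\<bar>) / 2 - \<bar>x\<bar>) / \<delta>"
      using \<delta> by (simp add: field_simps power2_eq_square)
    also have "(\<bar>x + \<delta>\<bar> + \<bar>x - \<delta>\<bar>) / 2 - \<bar>x\<bar> = max 0 (\<delta> - \<bar>x\<bar>)"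
      using \<delta> by (auto simp: max_def abs_if)
    also have "max 0 (\<delta> - \<bar>x\<bar>) / \<delta> = max 0 (1 - \<bar>x\<bar> / \<delta>)"
      using \<delta> by (auto simp: max_def field_simps)
    finally show ?thesis .
  qed
  ultimately show ?thesis by simp
qed

lemma triangle_coeff_bounds:
  assumes "0 < \<delta>"
  shows "0 \<le> triangle_coeff \<delta> n" "triangle_coeff \<delta> n \<le> 2 * \<delta>"
proof -
  show "0 \<le> triangle_coeff \<delta> n" using assms by (auto simp: triangle_coeff_def)
  show "triangle_coeff \<delta> n \<le> 2 * \<delta>"
  proof (cases "n = 0")
    case False
    have "1 - cos (2 * pi * n * \<delta>) = 2 * (sin (pi * n * \<delta>))\<^sup>2"
      using cos_double_sin[of "pi * n * \<delta>"] by (simp add: mult_ac)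
    also have "\<dots> \<le> 2 * (pi * n * \<delta>)\<^sup>2"
      using abs_sin_x_le_abs_x[of "pi * n * \<delta>"] by (simp add: abs_le_square_iff)
    finally show ?thesis using False assms
      by (simp add: triangle_coeff_def divide_le_eq power2_eq_square mult_ac)
  qed (use assms in \<open>simp add: triangle_coeff_def\<close>)
qed

text \<open>
  The trapezoid \<open>2 T\<^sub>2\<^sub>\<delta> - T\<^sub>\<delta>\<close> built from two triangles, which is 1 on \<open>[-\<delta>, \<delta>]\<close> and 0 outside
  \<open>[-2\<delta>, 2\<delta>]\<close>. The triangles have nonnegative coefficients with sum \<open>T(0) = 1\<close>; this gives the bound
  \<open>2 + 1\<close> on the absolute sum, uniformly in \<open>\<delta>\<close>.
\<close>

lemma wiener_bump:
  fixes \<delta> :: real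
  assumes \<delta>: "0 < \<delta>" "\<delta> \<le> 1 / 4"
  obtains h :: "nat \<Rightarrow> real" where
    "summable (\<lambda>n. \<bar>h n\<bar>)" "(\<Sum>n. \<bar>h n\<bar>) \<le> 3" "\<And>n. \<bar>h n\<bar> \<le> 10 * \<delta>" "h 0 = 3 * \<delta>"
    "\<And>x. 0 \<le> (\<Sum>n. h n * cos (2 * pi * n * x))"
    "\<And>x. (\<Sum>n. h n * cos (2 * pi * n * x)) \<le> 1"
    "\<And>x. cos (2 * pi * \<delta>) < cos (2 * pi * x) \<Longrightarrow> (\<Sum>n. h n * cos (2 * pi * n * x)) = 1"
proof -
  define t where "t = triangle_coeff"
  define h where "h n = 2 * t (2 * \<delta>) n - t \<delta> n" for n
  have tt: "t d sums 1" if "0 < d" "d \<le> 1 / 2" for d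
    using triangle_series[of d 0] that by (simp add: t_def)
  have t2: "(\<lambda>n. 2 * t (2 * \<delta>) n + t \<delta> n) sums (2 * 1 + 1)"
    using \<delta> by (intro sums_add sums_mult tt) auto
  have le: "\<bar>h n\<bar> \<le> 2 * t (2 * \<delta>) n + t \<delta> n" for n
    using triangle_coeff_bounds(1)[of "2 * \<delta>" n] triangle_coeff_bounds(1)[of \<delta> n] \<delta>
    by (simp add: h_def t_def)
  have sm: "summable (\<lambda>n. \<bar>h n\<bar>)"
    by (rule summable_comparison_test'[OF sums_summable[OF t2], of 0]) (use le in simp)
  have val: "(\<Sum>n. h n * cos (2 * pi * n * y)) = 2 * max 0 (1 - \<bar>y\<bar> / \<delta> / 2) - max 0 (1 - \<bar>y\<bar> / \<delta>)"
    if "\<bar>y\<bar> \<le> 1 / 2" for y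
  proof -
    have "(\<lambda>n. 2 * (t (2 * \<delta>) n * cos (2 * pi * n * y)) - t \<delta> n * cos (2 * pi * n * y)) sums
        (2 * max 0 (1 - \<bar>y\<bar> / (2 * \<delta>)) - max 0 (1 - \<bar>y\<bar> / \<delta>))"
      unfolding t_def using \<delta> that by (intro sums_diff sums_mult triangle_series) auto
    moreover have "\<bar>y\<bar> / (2 * \<delta>) = \<bar>y\<bar> / \<delta> / 2" by simp
    ultimately show ?thesis by (simp add: sums_iff h_def left_diff_distrib mult.assoc)
  qed
  \<comment> \<open>By periodicity it suffices to know the trapezoid on \<open>[-1/2, 1/2]\<close>.\<close>
  have red: "cos (2 * pi * real n * x) = cos (2 * pi * real n * (x - round x))" for n x
  proof -
    have "2 * pi * real n * x = 2 * pi * real n * (x - round x) + (2 * pi) * of_int (int n * round x)"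
      by (simp add: algebra_simps)
    then show ?thesis by (simp only: cos_add cos_int_2pin sin_int_2pin)
  qed
  have rnd: "\<bar>x - round x\<bar> \<le> 1 / 2" for x :: real
    using of_int_round_abs_le[of x] by (simp add: abs_minus_commute)
  have u: "0 \<le> \<bar>x - round x\<bar> / \<delta>" for x :: real using \<delta> by simp
  show ?thesis
  proof (rule that[of h])
    show "summable (\<lambda>n. \<bar>h n\<bar>)" by fact
    show "(\<Sum>n. \<bar>h n\<bar>) \<le> 3"
      using suminf_le[OF le sm] t2 by (simp add: sums_iff)
    show "\<bar>h n\<bar> \<le> 10 * \<delta>" for n
      using le[of n] triangle_coeff_bounds(2)[of "2 * \<delta>" n] triangle_coeff_bounds(2)[of \<delta> n] \<delta>
      by (simp add: t_def)
    show "h 0 = 3 * \<delta>" by (simp add: h_def t_def triangle_coeff_def)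
    show "0 \<le> (\<Sum>n. h n * cos (2 * pi * n * x))" for x
      unfolding red[of _ x] val[OF rnd] using u[of x] by (simp add: max_def)
    show "(\<Sum>n. h n * cos (2 * pi * n * x)) \<le> 1" for x
      unfolding red[of _ x] val[OF rnd] using u[of x] by (simp add: max_def)
    fix x :: real
    assume c: "cos (2 * pi * \<delta>) < cos (2 * pi * x)"
    define y where "y = \<bar>x - round x\<bar>"
    have "cos (2 * pi * x) = cos (2 * pi * y)"
    proof -
      have "cos (2 * pi * \<bar>z\<bar>) = cos (2 * pi * z)" for z :: real by (simp add: abs_if)
      then show ?thesis using red[of 1 x] by (simp only: y_def of_nat_1 mult_1_right)
    qed
    with c have "cos (2 * pi * \<delta>) < cos (2 * pi * y)" by simp
    then have "2 * pi * y < 2 * pi * \<delta>"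
      using \<delta> rnd[of x] by (subst (asm) cos_mono_less_eq) (auto simp: y_def)
    then have "y / \<delta> < 1" using \<delta> by simp
    then show "(\<Sum>n. h n * cos (2 * pi * n * x)) = 1"
      unfolding red[of _ x] val[OF rnd] y_def using u[of x] by (simp add: max_def)
  qed
qed

section \<open>Fourier transforms of densities and multiplication by cosine series\<close>

text \<open>
  The class of densities in which the construction takes place; it is stable under multiplication by
  functions with values in \<open>[0, 1]\<close>.
\<close>

definition profile :: "(real \<Rightarrow> real) \<Rightarrow> bool" where
  "profile f \<longleftrightarrow> f \<in> borel_measurable borel \<and> (\<forall>x. 0 \<le> f x \<and> f x \<le> 1) \<and> (\<forall>x. x \<notin> {0..1} \<longrightarrow> f x = 0)"

definition ft :: "(real \<Rightarrow> real) \<Rightarrow> real \<Rightarrow> complex" where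
  "ft f \<xi> = (\<integral>x. complex_of_real (f x) * exp (- (\<i> * complex_of_real x * complex_of_real \<xi>)) \<partial>lborel)"

lemma profile_measurable: "profile f \<Longrightarrow> f \<in> borel_measurable borel"
  by (simp add: profile_def)

lemma profile_le_indicator: "profile f \<Longrightarrow> \<bar>f x\<bar> \<le> indicator {0..1} x"
  by (auto simp: profile_def indicator_def)

lemma profile_mult:
  assumes "profile f" "g \<in> borel_measurable borel" "\<And>x. 0 \<le> g x" "\<And>x. g x \<le> 1"
  shows "profile (\<lambda>x. f x * g x)"
  using assms by (auto simp: profile_def intro: mult_le_one)

lemma integrable_unit_interval: "integrable lborel (indicator {0..1::real} :: real \<Rightarrow> real)"
  by simp

lemma profile_integrable: "profile f \<Longrightarrow> integrable lborel f"
  by (rule Bochner_Integration.integrable_bound[OF integrable_unit_interval])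
     (auto simp: profile_measurable profile_le_indicator)

lemma profile_integrable_exp:
  assumes "profile f"
  shows "integrable lborel (\<lambda>x. complex_of_real (f x) * exp (- (\<i> * complex_of_real x * complex_of_real \<xi>)))"
proof (rule Bochner_Integration.integrable_bound[OF integrable_unit_interval])
  have [measurable]: "f \<in> borel_measurable borel" using assms by (rule profile_measurable)
  show "(\<lambda>x. complex_of_real (f x) * exp (- (\<i> * complex_of_real x * complex_of_real \<xi>))) \<in> borel_measurable lborel"
    by measurable
qed (use profile_le_indicator[OF assms] in \<open>simp add: norm_mult\<close>)

lemma ft_diff:
  assumes "profile f" "profile g" "profile (\<lambda>x. f x - g x)"
  shows "ft (\<lambda>x. f x - g x) \<xi> = ft f \<xi> - ft g \<xi>"
  unfolding ft_def
  by (subst Bochner_Integration.integral_diff[symmetric])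
     (use assms in \<open>auto simp: profile_integrable_exp left_diff_distrib\<close>)

lemma ft_measurable [measurable]: "profile f \<Longrightarrow> ft f \<in> borel_measurable borel"
proof -
  assume "profile f"
  then have [measurable]: "f \<in> borel_measurable borel" by (rule profile_measurable)
  show ?thesis unfolding ft_def by measurable
qed

lemma norm_ft_le:
  assumes "profile f"
  shows "norm (ft f \<xi>) \<le> 1"
proof -
  have "norm (ft f \<xi>) \<le> (\<integral>x. norm (complex_of_real (f x) * exp (- (\<i> * complex_of_real x * complex_of_real \<xi>))) \<partial>lborel)"
    unfolding ft_def by (rule integral_norm_bound)
  also have "\<dots> \<le> (\<integral>x. indicator {0..1::real} x \<partial>lborel)"
    using assms profile_integrable_exp[OF assms]
    by (intro integral_mono integrable_norm integrable_unit_interval) (auto simp: norm_mult profile_le_indicator)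
  finally show ?thesis by simp
qed

lemma ft_zero: "ft f 0 = complex_of_real (\<integral>x. f x \<partial>lborel)"
  by (simp add: ft_def)

text \<open>
  Multiplication by a cosine of frequency \<open>nN\<close> averages the two translates of the transform by
  \<open>\<plusminus> 2\<pi> n N\<close>.
\<close>

lemma ft_mult_cos_series:
  assumes f: "profile f" and h: "summable (\<lambda>n. \<bar>h n\<bar>)"
  shows "(\<lambda>n. complex_of_real (h n / 2) *
            (ft f (\<xi> - 2 * pi * real (n * N)) + ft f (\<xi> + 2 * pi * real (n * N))))
      sums ft (\<lambda>x. f x * (\<Sum>n. h n * cos (2 * pi * real n * (real N * x)))) \<xi>"
proof -
  have [measurable]: "f \<in> borel_measurable borel" using f by (rule profile_measurable)
  define e where "e \<xi> x = exp (- (\<i> * complex_of_real x * complex_of_real \<xi>))" for \<xi> x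
  have [measurable]: "e \<xi> \<in> borel_measurable borel" for \<xi> unfolding e_def by measurable
  have ne: "norm (e \<xi> x) = 1" for \<xi> x by (simp add: e_def)
  define u where "u n x = complex_of_real (f x * (h n * cos (2 * pi * real n * (real N * x)))) * e \<xi> x" for n x
  have nu: "norm (u n x) \<le> \<bar>h n\<bar> * indicator {0..1} x" for n x
  proof -
    have "norm (u n x) = \<bar>h n\<bar> * (\<bar>f x\<bar> * \<bar>cos (2 * pi * real n * (real N * x))\<bar>)"
      by (simp add: u_def norm_mult ne abs_mult mult_ac)
    also have "\<dots> \<le> \<bar>h n\<bar> * (indicator {0..1} x * 1)"
      by (intro mult_left_mono mult_mono profile_le_indicator f) auto
    finally show ?thesis by simp
  qed
  have [measurable]: "u n \<in> borel_measurable borel" for n unfolding u_def by measurable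
  have int: "integrable lborel (u n)" for n
    by (rule Bochner_Integration.integrable_bound[of _ "\<lambda>x. \<bar>h n\<bar> * indicator {0..1} x"])
       (use nu[of n] in \<open>auto intro: order_trans[OF _ abs_ge_self]\<close>)
  have sm: "summable (\<lambda>n. norm (u n x))" for x
  proof (rule summable_comparison_test'[OF h])
    fix n :: nat
    have "norm (u n x) \<le> \<bar>h n\<bar> * 1"
      using nu[of n x] by (rule order_trans) (auto intro!: mult_left_mono simp: indicator_def)
    then show "norm (norm (u n x)) \<le> \<bar>h n\<bar>" by simp
  qed
  have "(\<lambda>n. integral\<^sup>L lborel (u n)) sums (\<integral>x. (\<Sum>n. u n x) \<partial>lborel)"
  proof (rule sums_integral[OF int])
    show "AE x in lborel. summable (\<lambda>n. norm (u n x))" using sm by simp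
    show "summable (\<lambda>n. \<integral>x. norm (u n x) \<partial>lborel)"
    proof (rule summable_comparison_test'[OF h])
      fix n :: nat
      have "(\<integral>x. norm (u n x) \<partial>lborel) \<le> (\<integral>x. \<bar>h n\<bar> * indicator {0..1::real} x \<partial>lborel)"
        by (rule integral_mono[OF integrable_norm[OF int]]) (use nu[of n] in auto)
      then show "norm (\<integral>x. norm (u n x) \<partial>lborel) \<le> \<bar>h n\<bar>" by simp
    qed
  qed
  moreover have "integral\<^sup>L lborel (u n) = complex_of_real (h n / 2) *
      (ft f (\<xi> - 2 * pi * real (n * N)) + ft f (\<xi> + 2 * pi * real (n * N)))" for n
  proof -
    have "u n x = complex_of_real (h n / 2) *
        (complex_of_real (f x) * e (\<xi> - 2 * pi * real (n * N)) x +
         complex_of_real (f x) * e (\<xi> + 2 * pi * real (n * N)) x)" for x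
    proof -
      define \<theta> where "\<theta> = 2 * pi * real n * (real N * x)"
      have "e (\<xi> - 2 * pi * real (n * N)) x = e \<xi> x * exp (\<i> * complex_of_real \<theta>)"
           "e (\<xi> + 2 * pi * real (n * N)) x = e \<xi> x * exp (- (\<i> * complex_of_real \<theta>))"
        by (simp_all add: e_def \<theta>_def algebra_simps flip: exp_add)
      moreover have "complex_of_real (cos \<theta>) = (exp (\<i> * complex_of_real \<theta>) + exp (- (\<i> * complex_of_real \<theta>))) / 2"
        by (simp only: cos_of_real[symmetric] cos_exp_eq)
      moreover have "a * (b * ((p + q) / 2)) * d = b / 2 * (a * (d * p) + a * (d * q))"
        for a b d p q :: complex by (simp add: field_simps)
      ultimately show ?thesis
        unfolding u_def \<theta>_def[symmetric] of_real_mult of_real_divide of_real_numeral by (simp only:)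
    qed
    then have "integral\<^sup>L lborel (u n) = (\<integral>x. complex_of_real (h n / 2) *
        (complex_of_real (f x) * e (\<xi> - 2 * pi * real (n * N)) x +
         complex_of_real (f x) * e (\<xi> + 2 * pi * real (n * N)) x) \<partial>lborel)"
      by (intro Bochner_Integration.integral_cong refl)
    also have "\<dots> = complex_of_real (h n / 2) *
      (ft f (\<xi> - 2 * pi * real (n * N)) + ft f (\<xi> + 2 * pi * real (n * N)))"
      unfolding ft_def e_def
      by (simp only: Bochner_Integration.integral_add profile_integrable_exp[OF f] integral_mult_right_zero)
    finally show ?thesis .
  qed
  moreover have "(\<integral>x. (\<Sum>n. u n x) \<partial>lborel) = ft (\<lambda>x. f x * (\<Sum>n. h n * cos (2 * pi * real n * (real N * x)))) \<xi>"
    unfolding ft_def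
  proof (intro Bochner_Integration.integral_cong refl)
    fix x
    have s: "summable (\<lambda>n. h n * cos (2 * pi * real n * (real N * x)))"
    proof (rule summable_norm_cancel, rule summable_comparison_test'[OF h])
      fix n :: nat
      show "norm (norm (h n * cos (2 * pi * real n * (real N * x)))) \<le> \<bar>h n\<bar>"
        using mult_left_mono[OF abs_cos_le_one, of "\<bar>h n\<bar>" "2 * pi * real n * (real N * x)"] by (simp add: abs_mult)
    qed
    have "(\<Sum>n. u n x) = (\<Sum>n. (complex_of_real (f x) * e \<xi> x) * complex_of_real (h n * cos (2 * pi * real n * (real N * x))))"
      by (simp add: u_def mult_ac)
    also have "\<dots> = (complex_of_real (f x) * e \<xi> x) * (\<Sum>n. complex_of_real (h n * cos (2 * pi * real n * (real N * x))))"
      by (rule suminf_mult, rule summable_of_real, rule s)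
    also have "(\<Sum>n. complex_of_real (h n * cos (2 * pi * real n * (real N * x)))) =
        complex_of_real (\<Sum>n. h n * cos (2 * pi * real n * (real N * x)))"
      by (rule suminf_of_real[OF s, symmetric])
    finally show "(\<Sum>n. u n x) = complex_of_real (f x * (\<Sum>n. h n * cos (2 * pi * real n * (real N * x)))) *
        exp (- (\<i> * complex_of_real x * complex_of_real \<xi>))"
      by (simp add: e_def)
  qed
  ultimately show ?thesis by simp
qed

text \<open>
  A norm between \<open>L\<^sup>1\<close> and \<open>L\<^sup>\<infinity>\<close> that is invariant under all translations. Summing over the lattice \<open>2\<pi> \<int>\<close> is
  what lets a bound on single coefficients control the whole combination of translates, whatever their
  spacing \<open>2\<pi> N\<close> is.
\<close>

definition lattice_bounded :: "(real \<Rightarrow> complex) \<Rightarrow> real \<Rightarrow> bool" where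
  "lattice_bounded F S \<longleftrightarrow>
     (\<forall>\<xi>. \<forall>K::int set. finite K \<longrightarrow> (\<Sum>k\<in>K. norm (F (\<xi> + 2 * pi * of_int k))) \<le> S)"

lemma lattice_boundedD:
  "lattice_bounded F S \<Longrightarrow> finite K \<Longrightarrow> (\<Sum>k\<in>K. norm (F (\<xi> + 2 * pi * of_int k))) \<le> S"
  by (simp add: lattice_bounded_def)

lemma lattice_bounded_norm: "lattice_bounded F S \<Longrightarrow> norm (F \<xi>) \<le> S"
  using lattice_boundedD[of F S "{0}" \<xi>] by simp

text \<open>
  The first two bounds are the triangle inequality for translation invariant norms and use the sum of the
  coefficients. The third one uses only their maximum: at a fixed \<open>\<xi>\<close> the translates are
  evaluated at distinct points of \<open>\<xi> + 2\<pi> \<int>\<close> on each side, so their total is at most \<open>S\<close> per side.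
\<close>

lemma shift_average_bounds:
  fixes F G :: "real \<Rightarrow> complex" and h :: "nat \<Rightarrow> real"
  assumes F: "lattice_bounded F S" and L: "(\<integral>\<^sup>+\<xi>. ennreal (norm (F \<xi>)) \<partial>lborel) \<le> ennreal L" "0 \<le> L"
    and meas [measurable]: "F \<in> borel_measurable borel"
    and h: "summable (\<lambda>n. \<bar>h n\<bar>)" "(\<Sum>n. \<bar>h n\<bar>) \<le> B" "\<And>n. \<bar>h n\<bar> \<le> m" and N: "N \<ge> 1"
    and G: "\<And>\<xi>. (\<lambda>n. complex_of_real (h n / 2) *
            (F (\<xi> - 2 * pi * real (n * N)) + F (\<xi> + 2 * pi * real (n * N)))) sums G \<xi>"
  shows "lattice_bounded G (B * S)" "(\<integral>\<^sup>+\<xi>. ennreal (norm (G \<xi>)) \<partial>lborel) \<le> ennreal (B * L)"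
    "norm (G \<xi>) \<le> m * S"
proof -
  have S0: "0 \<le> S" using lattice_boundedD[OF F, of "{}"] by simp
  have B0: "0 \<le> B" using suminf_nonneg[OF h(1)] h(2) by simp
  have m0: "0 \<le> m" using h(3)[of 0] by linarith
  define g where "g n \<xi> = complex_of_real (h n / 2) *
            (F (\<xi> - 2 * pi * real (n * N)) + F (\<xi> + 2 * pi * real (n * N)))" for n \<xi>
  define w where "w n \<xi> = \<bar>h n\<bar> / 2 *
            (norm (F (\<xi> - 2 * pi * real (n * N))) + norm (F (\<xi> + 2 * pi * real (n * N))))" for n \<xi>
  have gw: "norm (g n \<xi>) \<le> w n \<xi>" for n \<xi>
    unfolding g_def w_def norm_mult by (intro mult_mono norm_triangle_ineq) auto
  have w0: "0 \<le> w n \<xi>" for n \<xi> by (simp add: w_def)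
  have Glim: "(\<lambda>p. \<Sum>n<p. g n \<xi>) \<longlonglongrightarrow> G \<xi>" for \<xi>
    using G[of \<xi>] by (simp add: sums_def g_def)
  have part: "norm (\<Sum>n<p. g n \<xi>) \<le> (\<Sum>n<p. w n \<xi>)" for p \<xi>
    by (rule order_trans[OF norm_sum sum_mono]) (rule gw)
  show "norm (G \<xi>) \<le> m * S"
  proof (rule LIMSEQ_le_const2[OF tendsto_norm[OF Glim]], intro exI allI impI)
    fix p
    have inj: "inj_on (\<lambda>n. int (n * N)) {..<p}" "inj_on (\<lambda>n. - int (n * N)) {..<p}"
      using N by (auto simp: inj_on_def)
    have "(\<Sum>n<p. norm (F (\<xi> + 2 * pi * real (n * N)))) \<le> S"
      using lattice_boundedD[OF F, of "(\<lambda>n. int (n * N)) ` {..<p}" \<xi>] by (simp add: sum.reindex[OF inj(1)] del: of_nat_mult)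
    moreover have "(\<Sum>n<p. norm (F (\<xi> - 2 * pi * real (n * N)))) \<le> S"
      using lattice_boundedD[OF F, of "(\<lambda>n. - int (n * N)) ` {..<p}" \<xi>] by (simp add: sum.reindex[OF inj(2)] del: of_nat_mult)
    ultimately have *: "(\<Sum>n<p. norm (F (\<xi> - 2 * pi * real (n * N))) + norm (F (\<xi> + 2 * pi * real (n * N)))) \<le> S + S"
      by (simp add: sum.distrib)
    have "norm (\<Sum>n<p. g n \<xi>) \<le> (\<Sum>n<p. w n \<xi>)" by (rule part)
    also have "\<dots> \<le> (\<Sum>n<p. m / 2 * (norm (F (\<xi> - 2 * pi * real (n * N))) + norm (F (\<xi> + 2 * pi * real (n * N)))))"
      unfolding w_def using h(3) by (intro sum_mono mult_right_mono) auto
    also have "\<dots> \<le> m / 2 * (S + S)"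
      unfolding sum_distrib_left[symmetric] using * m0 by (intro mult_left_mono) auto
    finally show "norm (\<Sum>n<p. g n \<xi>) \<le> m * S" by simp
  qed
  show "lattice_bounded G (B * S)"
    unfolding lattice_bounded_def
  proof (intro allI impI)
    fix \<xi> and K :: "int set" assume K: "finite K"
    have "(\<lambda>p. \<Sum>k\<in>K. norm (\<Sum>n<p. g n (\<xi> + 2 * pi * of_int k))) \<longlonglongrightarrow> (\<Sum>k\<in>K. norm (G (\<xi> + 2 * pi * of_int k)))"
      by (intro tendsto_sum tendsto_norm Glim)
    moreover have "(\<Sum>k\<in>K. norm (\<Sum>n<p. g n (\<xi> + 2 * pi * of_int k))) \<le> B * S" for p
    proof -
      have "(\<Sum>k\<in>K. norm (\<Sum>n<p. g n (\<xi> + 2 * pi * of_int k))) \<le> (\<Sum>k\<in>K. \<Sum>n<p. w n (\<xi> + 2 * pi * of_int k))"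
        by (intro sum_mono part)
      also have "\<dots> = (\<Sum>n<p. \<Sum>k\<in>K. w n (\<xi> + 2 * pi * of_int k))" by (rule sum.swap)
      also have "\<dots> \<le> (\<Sum>n<p. \<bar>h n\<bar> * S)"
      proof (rule sum_mono)
        fix n
        have "(\<Sum>k\<in>K. w n (\<xi> + 2 * pi * of_int k)) = \<bar>h n\<bar> / 2 *
           ((\<Sum>k\<in>K. norm (F ((\<xi> - 2 * pi * real (n * N)) + 2 * pi * of_int k))) +
            (\<Sum>k\<in>K. norm (F ((\<xi> + 2 * pi * real (n * N)) + 2 * pi * of_int k))))"
          unfolding w_def sum_distrib_left[symmetric] sum.distrib by (simp add: algebra_simps)
        also have "\<dots> \<le> \<bar>h n\<bar> / 2 * (S + S)"
          by (intro mult_left_mono add_mono lattice_boundedD[OF F K]) auto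
        finally show "(\<Sum>k\<in>K. w n (\<xi> + 2 * pi * of_int k)) \<le> \<bar>h n\<bar> * S" by simp
      qed
      also have "\<dots> \<le> B * S"
        unfolding sum_distrib_right[symmetric]
        using sum_le_suminf[OF h(1), of "{..<p}"] h(2) S0 by (intro mult_right_mono) auto
      finally show ?thesis .
    qed
    ultimately show "(\<Sum>k\<in>K. norm (G (\<xi> + 2 * pi * of_int k))) \<le> B * S"
      by (intro LIMSEQ_le_const2) auto
  qed
  have shift: "(\<integral>\<^sup>+\<xi>. ennreal (norm (F (t + \<xi>))) \<partial>lborel) \<le> ennreal L" for t
    using L(1) nn_integral_real_affine[of "\<lambda>\<xi>. ennreal (norm (F \<xi>))" 1 t] by simp
  have wint: "(\<integral>\<^sup>+\<xi>. ennreal (w n \<xi>) \<partial>lborel) \<le> ennreal (\<bar>h n\<bar> * L)" for n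
  proof -
    have "(\<integral>\<^sup>+\<xi>. ennreal (w n \<xi>) \<partial>lborel) = (\<integral>\<^sup>+\<xi>. ennreal (\<bar>h n\<bar> / 2) *
       (ennreal (norm (F (- (2 * pi * real (n * N)) + \<xi>))) + ennreal (norm (F (2 * pi * real (n * N) + \<xi>)))) \<partial>lborel)"
    proof (intro nn_integral_cong)
      fix \<xi>
      have E: "ennreal (\<bar>h n\<bar> / 2 * (a + b)) = ennreal (\<bar>h n\<bar> / 2) * (ennreal a + ennreal b)"
        if "0 \<le> a" "0 \<le> b" for a b
        using that by (subst ennreal_mult', simp, subst ennreal_plus) auto
      show "ennreal (w n \<xi>) = ennreal (\<bar>h n\<bar> / 2) *
         (ennreal (norm (F (- (2 * pi * real (n * N)) + \<xi>))) + ennreal (norm (F (2 * pi * real (n * N) + \<xi>))))"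
        unfolding w_def by (subst E) (simp_all add: add.commute)
    qed
    also have "\<dots> = ennreal (\<bar>h n\<bar> / 2) * ((\<integral>\<^sup>+\<xi>. ennreal (norm (F (- (2 * pi * real (n * N)) + \<xi>))) \<partial>lborel)
        + (\<integral>\<^sup>+\<xi>. ennreal (norm (F (2 * pi * real (n * N) + \<xi>))) \<partial>lborel))"
      by (subst nn_integral_cmult, measurable, subst nn_integral_add) auto
    also have "\<dots> \<le> ennreal (\<bar>h n\<bar> / 2) * (ennreal L + ennreal L)"
      by (intro mult_left_mono add_mono shift) auto
    also have "\<dots> = ennreal (\<bar>h n\<bar> * L)"
      using L(2) by (simp add: ennreal_mult'[symmetric] flip: ennreal_plus)
    finally show ?thesis .
  qed
  have [measurable]: "w n \<in> borel_measurable borel" for n unfolding w_def by measurable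
  have "(\<integral>\<^sup>+\<xi>. ennreal (norm (G \<xi>)) \<partial>lborel) \<le> (\<integral>\<^sup>+\<xi>. (\<Sum>n. ennreal (w n \<xi>)) \<partial>lborel)"
  proof (rule nn_integral_mono)
    fix \<xi>
    show "ennreal (norm (G \<xi>)) \<le> (\<Sum>n. ennreal (w n \<xi>))"
    proof (rule LIMSEQ_le_const2[OF tendsto_ennrealI[OF tendsto_norm[OF Glim]]], intro exI allI impI)
      fix p
      have "ennreal (norm (\<Sum>n<p. g n \<xi>)) \<le> ennreal (\<Sum>n<p. w n \<xi>)" by (intro ennreal_leI part)
      also have "\<dots> = (\<Sum>n<p. ennreal (w n \<xi>))" by (simp add: w0)
      also have "\<dots> \<le> (\<Sum>n. ennreal (w n \<xi>))" by (intro sum_le_suminf summableI) auto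
      finally show "ennreal (norm (\<Sum>n<p. g n \<xi>)) \<le> (\<Sum>n. ennreal (w n \<xi>))" .
    qed
  qed
  also have "\<dots> = (\<Sum>n. \<integral>\<^sup>+\<xi>. ennreal (w n \<xi>) \<partial>lborel)" by (intro nn_integral_suminf) measurable
  also have "\<dots> \<le> (\<Sum>n. ennreal (\<bar>h n\<bar> * L))" by (intro suminf_le wint summableI)
  also have "\<dots> = ennreal ((\<Sum>n. \<bar>h n\<bar>) * L)"
    using L(2) h(1) by (subst suminf_ennreal2) (auto simp: suminf_mult2[symmetric] intro: summable_mult2)
  also have "\<dots> \<le> ennreal (B * L)" using L(2) h(2) by (intro ennreal_leI mult_right_mono) auto
  finally show "(\<integral>\<^sup>+\<xi>. ennreal (norm (G \<xi>)) \<partial>lborel) \<le> ennreal (B * L)" .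
qed

section \<open>The initial density\<close>

text \<open>
  The initial density. It vanishes at both end points of the interval, so its transform is
  \<open>O(1 / \<xi>\<^sup>2)\<close>, hence integrable.
\<close>

definition parabola :: "real \<Rightarrow> real" where
  "parabola x = indicator {0..1} x * (x * (1 - x))"

lemma profile_parabola: "profile parabola"
proof -
  have "x * (1 - x) \<le> 1 * 1" if "0 \<le> x" "x \<le> 1" for x :: real
    using that by (intro mult_mono) auto
  then show ?thesis by (auto simp: profile_def parabola_def[abs_def] indicator_def)
qed

lemma integral_parabola: "(\<integral>x. parabola x \<partial>lborel) = 1 / 6"
proof -
  have "has_bochner_integral lborel (\<lambda>x. indicator {0..1} x *\<^sub>R (x * (1 - x)))
      ((1\<^sup>2 / 2 - 1 ^ 3 / 3) - (0\<^sup>2 / 2 - 0 ^ 3 / 3 :: real))"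
    by (rule has_bochner_integral_FTC_Icc)
       (auto intro!: derivative_eq_intros continuous_intros
          simp: has_real_derivative_iff_has_vector_derivative[symmetric] power2_eq_square algebra_simps)
  then show ?thesis by (simp add: parabola_def has_bochner_integral_iff)
qed

text \<open>
  Antiderivative of \<open>exp (c x) p(x)\<close> for \<open>p(x) = x - x\<^sup>2\<close>: \<open>exp (c x) (p / c - p' / c\<^sup>2 + p'' / c\<^sup>3)\<close>.
\<close>

lemma ft_parabola:
  assumes "\<xi> \<noteq> 0"
  defines "c \<equiv> - (\<i> * complex_of_real \<xi>)"
  shows "ft parabola \<xi> = (exp c + 1) / c\<^sup>2 - 2 * (exp c - 1) / c ^ 3"
proof -
  have c: "c \<noteq> 0" using assms by simp
  define P where "P z = exp (c * z) * ((z - z\<^sup>2) / c - (1 - 2 * z) / c\<^sup>2 - 2 / c ^ 3)" for z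
  have dP: "(P has_field_derivative exp (c * z) * (z * (1 - z))) (at z within S)" for z S
    unfolding P_def using c
    by (auto intro!: derivative_eq_intros simp: field_simps power2_eq_square power3_eq_cube)
  have "has_bochner_integral lborel (\<lambda>x. indicator {0..1} x *\<^sub>R (exp (c * of_real x) * (of_real x * (1 - of_real x))))
      (P (of_real 1) - P (of_real 0))"
  proof (rule has_bochner_integral_FTC_Icc)
    show "((\<lambda>x. P (of_real x)) has_vector_derivative exp (c * of_real x) * (of_real x * (1 - of_real x)))
        (at x within {0..1})" for x :: real
      using field_vector_diff_chain_within[of of_real 1 x "{0..1}" P] dP has_vector_derivative_of_real[OF DERIV_ident]
      by (auto simp: o_def has_vector_derivative_at_within)
  qed (auto intro!: continuous_intros)
  then have "(\<integral>x. indicator {0..1} x *\<^sub>R (exp (c * of_real x) * (of_real x * (1 - of_real x))) \<partial>lborel) = P 1 - P 0"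
    by (simp add: has_bochner_integral_iff)
  also have "(\<integral>x. indicator {0..1} x *\<^sub>R (exp (c * of_real x) * (of_real x * (1 - of_real x))) \<partial>lborel) = ft parabola \<xi>"
    unfolding ft_def by (intro Bochner_Integration.integral_cong refl)
      (auto simp: parabola_def indicator_def c_def mult_ac)
  also have "P 1 - P 0 = (exp c + 1) / c\<^sup>2 - 2 * (exp c - 1) / c ^ 3"
    using c by (simp add: P_def field_simps power2_eq_square power3_eq_cube)
  finally show ?thesis .
qed

lemma norm_ft_parabola_le: "norm (ft parabola \<xi>) \<le> 12 / (1 + \<xi>\<^sup>2)"
proof (cases "\<bar>\<xi>\<bar> \<le> 1")
  case True
  then have "\<xi>\<^sup>2 \<le> 1" by (simp add: abs_square_le_1)
  then have "1 \<le> 12 / (1 + \<xi>\<^sup>2)" by (simp add: field_simps add_pos_nonneg)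
  then show ?thesis using norm_ft_le[OF profile_parabola, of \<xi>] by linarith
next
  case False
  define c where "c = - (\<i> * complex_of_real \<xi>)"
  have nc: "norm c = \<bar>\<xi>\<bar>" by (simp add: c_def norm_mult)
  have ne: "norm (exp c) = 1" by (simp add: c_def)
  have t: "norm (exp c + 1) \<le> 2" "norm (exp c - 1) \<le> 2"
    using norm_triangle_ineq[of "exp c" 1, unfolded ne norm_one]
      norm_triangle_ineq4[of "exp c" 1, unfolded ne norm_one] by simp_all
  have x2: "\<xi>\<^sup>2 \<ge> 1" using False by (simp add: abs_square_less_1 not_le flip: not_less)
  have "norm (ft parabola \<xi>) \<le> norm ((exp c + 1) / c\<^sup>2) + norm (2 * (exp c - 1) / c ^ 3)"
    using ft_parabola[of \<xi>] False unfolding c_def[symmetric] by (auto intro: norm_triangle_ineq4)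
  also have "norm ((exp c + 1) / c\<^sup>2) \<le> 2 / \<xi>\<^sup>2"
    using t by (simp add: norm_divide norm_power nc divide_right_mono)
  also have "norm (2 * (exp c - 1) / c ^ 3) \<le> 4 / \<bar>\<xi>\<bar> ^ 3"
  proof -
    have "norm (2 * (exp c - 1)) \<le> 4" using t(2) by (simp only: norm_mult) simp
    then show ?thesis unfolding norm_divide norm_power nc by (intro divide_right_mono) auto
  qed
  also have "4 / \<bar>\<xi>\<bar> ^ 3 \<le> 4 / \<xi>\<^sup>2"
  proof -
    have "\<xi>\<^sup>2 \<le> \<bar>\<xi>\<bar> ^ 3" using False power_increasing[of 2 3 "\<bar>\<xi>\<bar>"] by simp
    moreover have "\<xi> \<noteq> 0" using False by auto
    ultimately show ?thesis by (intro divide_left_mono) auto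
  qed
  also have "2 / \<xi>\<^sup>2 + 4 / \<xi>\<^sup>2 \<le> 12 / (1 + \<xi>\<^sup>2)"
  proof -
    have "12 / (2 * \<xi>\<^sup>2) \<le> 12 / (1 + \<xi>\<^sup>2)"
      using x2 by (intro divide_left_mono mult_pos_pos) auto
    then show ?thesis by (simp add: add_divide_distrib[symmetric])
  qed
  finally show ?thesis by simp
qed

lemma summable_inverse_one_plus_square: "summable (\<lambda>n. 1 / (1 + (real n)\<^sup>2))"
proof (rule summable_comparison_test_ev)
  show "summable (\<lambda>n. inverse ((real n)\<^sup>2))"
    using inverse_power_summable[of 2] by simp
  show "\<forall>\<^sub>F n in sequentially. norm (1 / (1 + (real n)\<^sup>2)) \<le> inverse ((real n)\<^sup>2)"
    using eventually_gt_at_top[of 0]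
    by eventually_elim (simp add: inverse_eq_divide frac_le)
qed

text \<open>
  The \<open>j\<close>-th nonnegative point of \<open>\<xi> + 2\<pi> \<int>\<close>, counted from \<open>j = 0\<close>, is at least \<open>2\<pi> j \<ge> j\<close>.
\<close>

lemma lattice_sum_le_half:
  fixes \<xi> :: real and K :: "int set"
  assumes K: "finite K" "\<And>k. k \<in> K \<Longrightarrow> 0 \<le> \<xi> + 2 * pi * of_int k"
  shows "(\<Sum>k\<in>K. 1 / (1 + (\<xi> + 2 * pi * of_int k)\<^sup>2)) \<le> (\<Sum>n. 1 / (1 + (real n)\<^sup>2))"
proof -
  define k0 where "k0 = \<lceil>- \<xi> / (2 * pi)\<rceil>"
  have ge: "k0 \<le> k" if "k \<in> K" for k
    using K(2)[OF that] by (simp add: k0_def ceiling_le_iff field_simps)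
  have k0: "0 \<le> \<xi> + 2 * pi * of_int k0"
  proof -
    have "- \<xi> / (2 * pi) \<le> of_int k0" by (simp only: k0_def le_of_int_ceiling)
    then have "- \<xi> \<le> of_int k0 * (2 * pi)" by (simp only: pos_divide_le_eq pi_gt_zero mult_pos_pos zero_less_numeral)
    then show ?thesis by (simp add: mult_ac)
  qed
  have inj: "inj_on (\<lambda>k. nat (k - k0)) K"
    using ge by (auto simp: inj_on_def) (smt (verit) ge nat_0_le)
  have "(\<Sum>k\<in>K. 1 / (1 + (\<xi> + 2 * pi * of_int k)\<^sup>2)) \<le> (\<Sum>k\<in>K. 1 / (1 + (real (nat (k - k0)))\<^sup>2))"
  proof (rule sum_mono)
    fix k assume k: "k \<in> K"
    have e1: "real (nat (k - k0)) = of_int (k - k0)" using ge[OF k] by simp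
    have e2: "real_of_int (k - k0) * 1 \<le> of_int (k - k0) * (2 * pi)"
      using ge[OF k] pi_ge_two by (intro mult_left_mono) auto
    have e3: "of_int (k - k0) * (2 * pi) \<le> \<xi> + 2 * pi * of_int k" using k0 by (simp add: algebra_simps)
    have "real (nat (k - k0)) \<le> \<xi> + 2 * pi * of_int k"
      unfolding e1 using order_trans[OF e2 e3] by (simp only: mult_1_right)
    then have "(real (nat (k - k0)))\<^sup>2 \<le> (\<xi> + 2 * pi * of_int k)\<^sup>2"
      by (intro power_mono) auto
    then show "1 / (1 + (\<xi> + 2 * pi * of_int k)\<^sup>2) \<le> 1 / (1 + (real (nat (k - k0)))\<^sup>2)"
      by (intro divide_left_mono mult_pos_pos add_pos_nonneg) auto
  qed
  also have "\<dots> = (\<Sum>n\<in>(\<lambda>k. nat (k - k0)) ` K. 1 / (1 + (real n)\<^sup>2))"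
    by (simp add: sum.reindex[OF inj])
  also have "\<dots> \<le> (\<Sum>n. 1 / (1 + (real n)\<^sup>2))"
    using K(1) by (intro sum_le_suminf summable_inverse_one_plus_square) auto
  finally show ?thesis .
qed

lemma lattice_sum_le:
  fixes \<xi> :: real and K :: "int set"
  assumes K: "finite K"
  shows "(\<Sum>k\<in>K. 1 / (1 + (\<xi> + 2 * pi * of_int k)\<^sup>2)) \<le> 2 * (\<Sum>n. 1 / (1 + (real n)\<^sup>2))"
proof -
  let ?u = "\<lambda>\<xi> k. 1 / (1 + (\<xi> + 2 * pi * of_int k)\<^sup>2)"
  define K1 where "K1 = {k \<in> K. 0 \<le> \<xi> + 2 * pi * of_int k}"
  define K2 where "K2 = {k \<in> K. \<not> 0 \<le> \<xi> + 2 * pi * of_int k}"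
  have "(\<Sum>k\<in>K. ?u \<xi> k) = (\<Sum>k\<in>K1. ?u \<xi> k) + (\<Sum>k\<in>K2. ?u \<xi> k)"
    using K by (subst sum.union_disjoint[symmetric]) (auto simp: K1_def K2_def intro!: sum.cong)
  also have "(\<Sum>k\<in>K2. ?u \<xi> k) = (\<Sum>k\<in>uminus ` K2. ?u (- \<xi>) k)"
  proof -
    have "(- (2 * pi * of_int k) - \<xi>)\<^sup>2 = (\<xi> + 2 * pi * of_int k)\<^sup>2" for k
      by (simp add: power2_eq_square algebra_simps)
    then show ?thesis by (subst sum.reindex) (auto simp: inj_on_def)
  qed
  also have "(\<Sum>k\<in>K1. ?u \<xi> k) + (\<Sum>k\<in>uminus ` K2. ?u (- \<xi>) k) \<le>
      (\<Sum>n. 1 / (1 + (real n)\<^sup>2)) + (\<Sum>n. 1 / (1 + (real n)\<^sup>2))"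
    using K by (intro add_mono lattice_sum_le_half) (auto simp: K1_def K2_def)
  finally show ?thesis by simp
qed

lemma lattice_bounded_parabola:
  "lattice_bounded (ft parabola) (24 * (\<Sum>n. 1 / (1 + (real n)\<^sup>2)))"
  unfolding lattice_bounded_def
proof (intro allI impI)
  fix \<xi> and K :: "int set" assume K: "finite K"
  have "(\<Sum>k\<in>K. norm (ft parabola (\<xi> + 2 * pi * of_int k))) \<le> (\<Sum>k\<in>K. 12 * (1 / (1 + (\<xi> + 2 * pi * of_int k)\<^sup>2)))"
    by (intro sum_mono) (use norm_ft_parabola_le in simp)
  also have "\<dots> \<le> 12 * (2 * (\<Sum>n. 1 / (1 + (real n)\<^sup>2)))"
    unfolding sum_distrib_left[symmetric] by (intro mult_left_mono lattice_sum_le K) auto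
  finally show "(\<Sum>k\<in>K. norm (ft parabola (\<xi> + 2 * pi * of_int k))) \<le> 24 * (\<Sum>n. 1 / (1 + (real n)\<^sup>2))"
    by simp
qed

lemma ft_parabola_integrable:
  obtains L where "0 \<le> L" "(\<integral>\<^sup>+\<xi>. ennreal (norm (ft parabola \<xi>)) \<partial>lborel) \<le> ennreal L"
proof -
  have "integrable lborel (\<lambda>x::real. inverse (1 + x\<^sup>2))"
    using integrable_inverse_1_plus_square by (simp add: set_integrable_def)
  then have i: "integrable lborel (\<lambda>x::real. 12 * inverse (1 + x\<^sup>2))" by simp
  have "(\<integral>\<^sup>+\<xi>. ennreal (norm (ft parabola \<xi>)) \<partial>lborel) \<le> (\<integral>\<^sup>+x. ennreal (12 * inverse (1 + x\<^sup>2)) \<partial>lborel)"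
    using norm_ft_parabola_le by (intro nn_integral_mono ennreal_leI) (simp add: divide_inverse)
  also have "\<dots> = ennreal (\<integral>x. 12 * inverse (1 + x\<^sup>2 :: real) \<partial>lborel)"
    by (rule nn_integral_eq_integral[OF i]) (auto intro!: AE_I2 add_nonneg_nonneg)
  finally show ?thesis by (intro that[of "\<integral>x. 12 * inverse (1 + x\<^sup>2 :: real) \<partial>lborel"] integral_nonneg_AE) auto
qed

section \<open>Integrability of powers from superexponentially small layers\<close>

text \<open>
  A substitute for Minkowski's inequality: peel off one summand at a time with
  \<open>(x + y)^r \<le> 2^r (x^r + y^r)\<close>. The exponential weights are harmless for layers that decay
  superexponentially.
\<close>

lemma powr_sum_le:
  fixes a :: "nat \<Rightarrow> real"
  assumes r: "r \<ge> 0" and a: "\<And>j. 0 \<le> a j"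
  shows "(\<Sum>j<n. a j) powr r \<le> (\<Sum>j<n. (2 powr r) ^ Suc j * a j powr r)"
  using a
proof (induction n arbitrary: a)
  case (Suc n)
  have max: "(x + y) powr r \<le> 2 powr r * x powr r + 2 powr r * y powr r" if "0 \<le> x" "0 \<le> y" for x y :: real
  proof -
    have "(x + y) powr r \<le> (2 * max x y) powr r" using that r by (intro powr_mono2) auto
    also have "\<dots> = 2 powr r * max x y powr r" using that by (simp add: powr_mult)
    also have "\<dots> \<le> 2 powr r * x powr r + 2 powr r * y powr r" by (simp add: max_def)
    finally show ?thesis .
  qed
  have "(\<Sum>j<Suc n. a j) powr r = (a 0 + (\<Sum>j<n. a (Suc j))) powr r"
    by (simp only: sum.lessThan_Suc_shift)
  also have "\<dots> \<le> 2 powr r * a 0 powr r + 2 powr r * (\<Sum>j<n. a (Suc j)) powr r"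
    by (intro max sum_nonneg Suc.prems)
  also have "\<dots> \<le> 2 powr r * a 0 powr r + 2 powr r * (\<Sum>j<n. (2 powr r) ^ Suc j * a (Suc j) powr r)"
    by (intro add_mono mult_left_mono Suc.IH Suc.prems) auto
  also have "\<dots> = (\<Sum>j<Suc n. (2 powr r) ^ Suc j * a j powr r)"
    unfolding sum.lessThan_Suc_shift sum_distrib_left by (simp add: mult_ac)
  finally show ?case .
qed simp

text \<open>
  A layer with \<open>0 \<le> a \<le> M\<close> satisfies \<open>a^r \<le> M^(r-1) a\<close>, so its \<open>L\<^sup>r\<close> size is controlled by its supremum and
  its \<open>L\<^sup>1\<close> norm.
\<close>

lemma Lp_of_layers:
  fixes F :: "real \<Rightarrow> complex" and a :: "nat \<Rightarrow> real \<Rightarrow> real"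
  assumes r: "r > 1" and meas [measurable]: "F \<in> borel_measurable borel" "\<And>j. a j \<in> borel_measurable borel"
    and a: "\<And>j \<xi>. 0 \<le> a j \<xi>" "\<And>j \<xi>. a j \<xi> \<le> M j"
    and L: "\<And>j. (\<integral>\<^sup>+\<xi>. ennreal (a j \<xi>) \<partial>lborel) \<le> ennreal (L j)" "\<And>j. 0 \<le> L j"
    and sm: "summable (\<lambda>j. (2 powr r) ^ Suc j * (M j powr (r - 1) * L j))"
    and lim: "\<And>\<xi>. (\<lambda>n. F' n \<xi>) \<longlonglongrightarrow> F \<xi>" and le: "\<And>n \<xi>. norm (F' n \<xi>) \<le> (\<Sum>j<n. a j \<xi>)"
  shows "integrable lborel (\<lambda>\<xi>. norm (F \<xi>) powr r)"
proof (rule integrableI_bounded)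
  have pt: "ennreal (norm (F \<xi>) powr r) \<le> (\<Sum>j. ennreal ((2 powr r) ^ Suc j * (M j powr (r - 1) * a j \<xi>)))" for \<xi>
  proof (rule LIMSEQ_le_const2)
    show "(\<lambda>n. ennreal (norm (F' n \<xi>) powr r)) \<longlonglongrightarrow> ennreal (norm (F \<xi>) powr r)"
      using r by (intro tendsto_ennrealI tendsto_powr' tendsto_norm lim tendsto_const) auto
    have "ennreal (norm (F' n \<xi>) powr r) \<le> (\<Sum>j. ennreal ((2 powr r) ^ Suc j * (M j powr (r - 1) * a j \<xi>)))" for n
    proof -
      have layer: "a j \<xi> powr r \<le> M j powr (r - 1) * a j \<xi>" for j
      proof -
        have "a j \<xi> powr r = a j \<xi> powr (r - 1) * a j \<xi>"
          using a(1)[of j \<xi>] by (cases "a j \<xi> = 0") (simp_all add: powr_diff)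
        also have "\<dots> \<le> M j powr (r - 1) * a j \<xi>"
          using a[of j \<xi>] r by (intro mult_right_mono powr_mono2) auto
        finally show ?thesis .
      qed
      have "norm (F' n \<xi>) powr r \<le> (\<Sum>j<n. a j \<xi>) powr r" using le r by (intro powr_mono2) auto
      also have "\<dots> \<le> (\<Sum>j<n. (2 powr r) ^ Suc j * a j \<xi> powr r)" using r a by (intro powr_sum_le) auto
      also have "\<dots> \<le> (\<Sum>j<n. (2 powr r) ^ Suc j * (M j powr (r - 1) * a j \<xi>))"
        by (intro sum_mono mult_left_mono layer) auto
      finally have "ennreal (norm (F' n \<xi>) powr r) \<le> ennreal (\<Sum>j<n. (2 powr r) ^ Suc j * (M j powr (r - 1) * a j \<xi>))"
        by (rule ennreal_leI)
      also have "\<dots> = (\<Sum>j<n. ennreal ((2 powr r) ^ Suc j * (M j powr (r - 1) * a j \<xi>)))"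
        using a(1) by (intro sum_ennreal[symmetric]) auto
      also have "\<dots> \<le> (\<Sum>j. ennreal ((2 powr r) ^ Suc j * (M j powr (r - 1) * a j \<xi>)))"
        by (intro sum_le_suminf summableI) auto
      finally show ?thesis .
    qed
    then show "\<exists>N. \<forall>n\<ge>N. ennreal (norm (F' n \<xi>) powr r) \<le> (\<Sum>j. ennreal ((2 powr r) ^ Suc j * (M j powr (r - 1) * a j \<xi>)))"
      by blast
  qed
  have "(\<integral>\<^sup>+\<xi>. ennreal (norm (norm (F \<xi>) powr r)) \<partial>lborel) \<le>
      (\<integral>\<^sup>+\<xi>. (\<Sum>j. ennreal ((2 powr r) ^ Suc j * (M j powr (r - 1) * a j \<xi>))) \<partial>lborel)"
    by (intro nn_integral_mono) (simp only: real_norm_def abs_of_nonneg powr_ge_zero pt)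
  also have "\<dots> = (\<Sum>j. \<integral>\<^sup>+\<xi>. ennreal ((2 powr r) ^ Suc j * (M j powr (r - 1) * a j \<xi>)) \<partial>lborel)"
    by (intro nn_integral_suminf) measurable
  also have "\<dots> \<le> (\<Sum>j. ennreal ((2 powr r) ^ Suc j * (M j powr (r - 1) * L j)))"
  proof (intro suminf_le summableI)
    fix j
    define c where "c = (2 powr r) ^ Suc j * M j powr (r - 1)"
    have c: "0 \<le> c" by (simp add: c_def)
    have "(\<integral>\<^sup>+\<xi>. ennreal (c * a j \<xi>) \<partial>lborel) = ennreal c * (\<integral>\<^sup>+\<xi>. ennreal (a j \<xi>) \<partial>lborel)"
      using c by (subst nn_integral_cmult[symmetric]) (auto simp: ennreal_mult')
    also have "\<dots> \<le> ennreal c * ennreal (L j)" by (intro mult_left_mono L) auto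
    also have "\<dots> = ennreal (c * L j)" using c by (simp add: ennreal_mult')
    finally show "(\<integral>\<^sup>+\<xi>. ennreal ((2 powr r) ^ Suc j * (M j powr (r - 1) * a j \<xi>)) \<partial>lborel)
      \<le> ennreal ((2 powr r) ^ Suc j * (M j powr (r - 1) * L j))" by (simp only: c_def mult.assoc)
  qed
  also have "\<dots> = ennreal (\<Sum>j. (2 powr r) ^ Suc j * (M j powr (r - 1) * L j))"
    using sm L(2) by (intro suminf_ennreal2) auto
  also have "\<dots> < \<infinity>" by simp
  finally show "(\<integral>\<^sup>+\<xi>. ennreal (norm (norm (F \<xi>) powr r)) \<partial>lborel) < \<infinity>" .
qed measurable

text \<open>
  The general term is \<open>(K q^j)^j\<close>, and \<open>K q^j\<close> is eventually below \<open>1/2\<close>.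
\<close>

lemma summable_power_square:
  fixes K q :: real
  assumes "0 \<le> K" "0 \<le> q" "q < 1"
  shows "summable (\<lambda>j. K ^ j * q ^ (j\<^sup>2))"
proof (rule summable_comparison_test_ev)
  have "(\<lambda>j. K * q ^ j) \<longlonglongrightarrow> K * 0"
    using assms by (intro tendsto_intros LIMSEQ_power_zero) auto
  then have "\<forall>\<^sub>F j in sequentially. K * q ^ j < 1 / 2" by (rule order_tendstoD) simp
  then show "\<forall>\<^sub>F j in sequentially. norm (K ^ j * q ^ (j\<^sup>2)) \<le> (1 / 2) ^ j"
  proof eventually_elim
    case (elim j)
    have "K ^ j * q ^ (j\<^sup>2) = (K * q ^ j) ^ j"
      by (simp add: power_mult_distrib power2_eq_square flip: power_mult)
    also have "\<dots> \<le> (1 / 2) ^ j" using elim assms by (intro power_mono) auto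
    finally show ?case using assms by simp
  qed
qed (simp add: summable_geometric)

section \<open>The infinite product\<close>

lemma profile_indicator: "profile (indicator {0..1})"
  by (auto simp: profile_def indicator_def)

lemma ft_indicator_lattice:
  assumes "k \<noteq> 0"
  shows "ft (indicator {0..1}) (2 * pi * of_int k) = 0"
proof -
  define c where "c = - (\<i> * complex_of_real (2 * pi * of_int k))"
  have c: "c \<noteq> 0" using assms by (simp add: c_def)
  define P where "P z = exp (c * z) / c" for z
  have dP: "(P has_field_derivative exp (c * z)) (at z within S)" for z S
    unfolding P_def using c by (auto intro!: derivative_eq_intros)
  have "has_bochner_integral lborel (\<lambda>x. indicator {0..1} x *\<^sub>R exp (c * of_real x)) (P (of_real 1) - P (of_real 0))"
  proof (rule has_bochner_integral_FTC_Icc)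
    show "((\<lambda>x. P (of_real x)) has_vector_derivative exp (c * of_real x)) (at x within {0..1})" for x :: real
      using field_vector_diff_chain_within[of of_real 1 x "{0..1}" P] dP has_vector_derivative_of_real[OF DERIV_ident]
      by (auto simp: o_def has_vector_derivative_at_within)
  qed (auto intro!: continuous_intros)
  then have "(\<integral>x. indicator {0..1} x *\<^sub>R exp (c * of_real x) \<partial>lborel) = P 1 - P 0"
    by (simp add: has_bochner_integral_iff)
  also have "(\<integral>x. indicator {0..1} x *\<^sub>R exp (c * of_real x) \<partial>lborel) = ft (indicator {0..1}) (2 * pi * of_int k)"
    unfolding ft_def by (intro Bochner_Integration.integral_cong refl)
      (auto simp: indicator_def c_def mult_ac)
  also have "exp c = 1"
  proof -
    have "c = 2 * of_int (- k) * of_real pi * \<i>" by (simp add: c_def)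
    then show ?thesis by (simp only: exp_eq_1) (auto intro!: exI[of _ "- k"])
  qed
  then have "P 1 - P 0 = 0" by (simp add: P_def)
  finally show ?thesis by simp
qed

text \<open>
  All nonconstant terms have an integral number of periods in \<open>[0, 1]\<close>, as \<open>N\<close> is a positive integer.
\<close>

lemma integral_dilated_cos_series:
  assumes h: "summable (\<lambda>n. \<bar>h n\<bar>)" and N: "N \<ge> 1"
  shows "(\<integral>x. indicator {0..1} x * (\<Sum>n. h n * cos (2 * pi * real n * (real N * x))) \<partial>lborel) = h 0"
proof -
  have "(\<lambda>n. complex_of_real (h n / 2) *
            (ft (indicator {0..1}) (0 - 2 * pi * real (n * N)) + ft (indicator {0..1}) (0 + 2 * pi * real (n * N))))
      sums ft (\<lambda>x. indicator {0..1} x * (\<Sum>n. h n * cos (2 * pi * real n * (real N * x)))) 0"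
    by (rule ft_mult_cos_series[OF profile_indicator h])
  moreover have "complex_of_real (h n / 2) *
            (ft (indicator {0..1}) (0 - 2 * pi * real (n * N)) + ft (indicator {0..1}) (0 + 2 * pi * real (n * N)))
        = (if n = 0 then complex_of_real (h n) else 0)" for n
  proof (cases "n = 0")
    case True
    then show ?thesis by (simp add: ft_zero)
  next
    case False
    then show ?thesis
      using ft_indicator_lattice[of "int (n * N)"] ft_indicator_lattice[of "- int (n * N)"] N by simp
  qed
  ultimately have "(\<lambda>n. if n = 0 then complex_of_real (h n) else 0) sums
      ft (\<lambda>x. indicator {0..1} x * (\<Sum>n. h n * cos (2 * pi * real n * (real N * x)))) 0"
    by (simp only:)
  from sums_unique2[OF this sums_single[of 0 "\<lambda>n. complex_of_real (h n)"]]
  show ?thesis unfolding ft_zero of_real_eq_iff by simp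
qed

lemma lattice_bounded_diff:
  assumes "lattice_bounded F S" "lattice_bounded G T"
  shows "lattice_bounded (\<lambda>\<xi>. F \<xi> - G \<xi>) (S + T)"
  unfolding lattice_bounded_def
proof (intro allI impI)
  fix \<xi> and K :: "int set" assume K: "finite K"
  have "(\<Sum>k\<in>K. norm (F (\<xi> + 2 * pi * of_int k) - G (\<xi> + 2 * pi * of_int k)))
    \<le> (\<Sum>k\<in>K. norm (F (\<xi> + 2 * pi * of_int k)) + norm (G (\<xi> + 2 * pi * of_int k)))"
    by (intro sum_mono norm_triangle_ineq4)
  also have "\<dots> \<le> S + T"
    unfolding sum.distrib using assms K by (intro add_mono lattice_boundedD)
  finally show "(\<Sum>k\<in>K. norm (F (\<xi> + 2 * pi * of_int k) - G (\<xi> + 2 * pi * of_int k))) \<le> S + T" .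
qed

text \<open>
  The bounds for the layers of the product: supremum \<open>10 \<delta>\<^sub>j 4^j S\<close> and \<open>L\<^sup>1\<close> norm \<open>3 4^j L\<close>. For every
  \<open>r > 1\<close> the factor \<open>\<delta>\<^sub>j^(r-1) = (2^(-(r-1)))^(j\<^sup>2) / 80^(r-1)\<close> outweighs all exponentials in \<open>j\<close>.
\<close>

lemma layer_summable:
  fixes S L r :: real
  assumes "0 \<le> S" "1 < r"
  shows "summable (\<lambda>j. (2 powr r) ^ Suc (Suc j) *
      ((10 * ((1 / 2) ^ (j\<^sup>2) / 80) * (4 ^ j * S)) powr (r - 1) * (3 * (4 ^ j * L))))"
proof -
  define K where "K = 2 powr r * 4 powr (r - 1) * 4"
  define q :: real where "q = (1 / 2) powr (r - 1)"
  have q: "0 \<le> q" "q < 1" using assms powr_less_mono'[of "1/2" 0 "r - 1"] by (simp_all add: q_def)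
  have pw: "(x ^ n) powr s = (x powr s) ^ n" if "x > 0" for x s :: real and n
    using that by (simp add: powr_powr mult.commute flip: powr_realpow)
  have "(2 powr r) ^ Suc (Suc j) * ((10 * ((1 / 2) ^ (j\<^sup>2) / 80) * (4 ^ j * S)) powr (r - 1) * (3 * (4 ^ j * L)))
      = ((2 powr r)\<^sup>2 * (S / 8) powr (r - 1) * 3 * L) * (K ^ j * q ^ (j\<^sup>2))" for j
  proof -
    have "10 * ((1 / 2) ^ (j\<^sup>2) / 80) * (4 ^ j * S) = (1 / 2) ^ (j\<^sup>2) * (4 ^ j * (S / 8))" by simp
    also have "\<dots> powr (r - 1) = q ^ (j\<^sup>2) * ((4 powr (r - 1)) ^ j * (S / 8) powr (r - 1))"
      by (simp only: powr_mult pw q_def zero_less_divide_1_iff zero_less_numeral)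
    finally show ?thesis by (simp add: K_def power_mult_distrib power2_eq_square mult_ac)
  qed
  then show ?thesis
    using q by (simp only:) (intro summable_mult summable_power_square, auto simp: K_def)
qed

text \<open>
  The partial products decrease to \<open>f\<close>. Their transforms \<open>F n\<close> satisfy \<open>F (n + 1) = F n - G n\<close>, where \<open>G n\<close> is
  a combination of translates of \<open>F n\<close>; \<open>F 0\<close> and the \<open>G n\<close> are the layers that build up the transform of
  \<open>f\<close>. The growth by the factor \<open>4 = 1 + 3\<close> per step comes from the bound 3 on the absolute sums of the
  coefficients.
\<close>

lemma wiener_product:
  fixes h :: "nat \<Rightarrow> nat \<Rightarrow> real" and N :: "nat \<Rightarrow> nat" and \<eta> :: "nat \<Rightarrow> real \<Rightarrow> real"
  defines "\<eta> \<equiv> \<lambda>j x. \<Sum>n. h j n * cos (2 * pi * real n * x)"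
  assumes h: "\<And>j. summable (\<lambda>n. \<bar>h j n\<bar>)" "\<And>j. (\<Sum>n. \<bar>h j n\<bar>) \<le> 3"
      "\<And>j n. \<bar>h j n\<bar> \<le> 10 * ((1 / 2) ^ (j\<^sup>2) / 80)" "\<And>j. h j 0 = 3 * ((1 / 2) ^ (j\<^sup>2) / 80)"
    and \<eta>: "\<And>j x. 0 \<le> \<eta> j x" "\<And>j x. \<eta> j x \<le> 1" and N: "\<And>j. N j \<ge> 1"
  obtains f where "profile f" "(\<integral>x. f x \<partial>lborel) > 0"
    "\<And>r. r > 1 \<Longrightarrow> integrable lborel (\<lambda>\<xi>. norm (ft f \<xi>) powr r)"
    "\<And>j x. \<eta> j (real (N j) * x) = 1 \<Longrightarrow> f x = 0"
proof -
  define d :: "nat \<Rightarrow> real" where "d j = (1 / 2) ^ (j\<^sup>2) / 80" for j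
  define g where "g j x = \<eta> j (real (N j) * x)" for j x
  have g_eq: "g j x = (\<Sum>n. h j n * cos (2 * pi * real n * (real (N j) * x)))" for j x
    by (simp add: g_def \<eta>_def)
  have g: "0 \<le> g j x" "g j x \<le> 1" for j x using \<eta> by (auto simp: g_def)
  have gm [measurable]: "g j \<in> borel_measurable borel" for j unfolding g_eq[abs_def] by measurable
  define p where "p n x = parabola x * (\<Prod>j<n. 1 - g j x)" for n x
  have p0: "p 0 = parabola" by (simp add: p_def[abs_def])
  have pSuc: "p (Suc n) = (\<lambda>x. p n x - p n x * g n x)" for n
    by (rule ext) (simp add: p_def algebra_simps)
  have prof: "profile (p n)" and profg: "profile (\<lambda>x. p n x * g n x)" for n
  proof -
    show pn: "profile (p n)"
    proof (induction n)
      case (Suc n)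
      have "profile (\<lambda>x. p n x * (1 - g n x))"
        by (rule profile_mult[OF Suc.IH]) (use g in auto)
      then show ?case by (simp add: pSuc algebra_simps)
    qed (simp add: p0 profile_parabola)
    show "profile (\<lambda>x. p n x * g n x)" by (rule profile_mult[OF pn]) (use g in auto)
  qed
  have [measurable]: "p n \<in> borel_measurable borel" for n by (rule profile_measurable[OF prof])
  define F where "F n = ft (p n)" for n
  define G where "G n = ft (\<lambda>x. p n x * g n x)" for n
  have FSuc: "F (Suc n) = (\<lambda>\<xi>. F n \<xi> - G n \<xi>)" for n
    unfolding F_def G_def pSuc using prof[of "Suc n"] unfolding pSuc
    by (intro ext ft_diff prof profg)
  have [measurable]: "F n \<in> borel_measurable borel" "G n \<in> borel_measurable borel" for n
    unfolding F_def G_def by (rule ft_measurable[OF prof], rule ft_measurable[OF profg])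
  define S where "S = 24 * (\<Sum>n. 1 / (1 + (real n)\<^sup>2))"
  have S0: "0 \<le> S" unfolding S_def by (intro mult_nonneg_nonneg suminf_nonneg summable_inverse_one_plus_square) auto
  obtain L where L0: "0 \<le> L" and L: "(\<integral>\<^sup>+\<xi>. ennreal (norm (ft parabola \<xi>)) \<partial>lborel) \<le> ennreal L"
    by (rule ft_parabola_integrable)
  have Gstep: "lattice_bounded (G n) (3 * (4 ^ n * S)) \<and>
      (\<integral>\<^sup>+\<xi>. ennreal (norm (G n \<xi>)) \<partial>lborel) \<le> ennreal (3 * (4 ^ n * L)) \<and>
      (\<forall>\<xi>. norm (G n \<xi>) \<le> 10 * d n * (4 ^ n * S))"
    if "lattice_bounded (F n) (4 ^ n * S)" "(\<integral>\<^sup>+\<xi>. ennreal (norm (F n \<xi>)) \<partial>lborel) \<le> ennreal (4 ^ n * L)" for n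
  proof -
    have sums: "(\<lambda>k. complex_of_real (h n k / 2) *
            (F n (\<xi> - 2 * pi * real (k * N n)) + F n (\<xi> + 2 * pi * real (k * N n)))) sums G n \<xi>" for \<xi>
      unfolding F_def G_def g_eq by (rule ft_mult_cos_series[OF prof h(1)])
    have m: "\<bar>h n k\<bar> \<le> 10 * d n" for k using h(3) by (simp add: d_def)
    have L': "0 \<le> 4 ^ n * L" using L0 by simp
    have Fm: "F n \<in> borel_measurable borel" by measurable
    from shift_average_bounds[OF that L' Fm h(1) h(2) m N sums] show ?thesis by blast
  qed
  have FB: "lattice_bounded (F n) (4 ^ n * S) \<and> (\<integral>\<^sup>+\<xi>. ennreal (norm (F n \<xi>)) \<partial>lborel) \<le> ennreal (4 ^ n * L)" for n
  proof (induction n)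
    case 0
    show ?case using lattice_bounded_parabola L by (simp add: F_def p0 S_def)
  next
    case (Suc n)
    note G = Gstep[OF conjunct1[OF Suc.IH] conjunct2[OF Suc.IH]]
    have "lattice_bounded (F (Suc n)) (4 ^ n * S + 3 * (4 ^ n * S))"
      unfolding FSuc using Suc.IH G by (intro lattice_bounded_diff) auto
    moreover have "(\<integral>\<^sup>+\<xi>. ennreal (norm (F (Suc n) \<xi>)) \<partial>lborel) \<le> ennreal (4 ^ Suc n * L)"
    proof -
      have "(\<integral>\<^sup>+\<xi>. ennreal (norm (F (Suc n) \<xi>)) \<partial>lborel) \<le>
          (\<integral>\<^sup>+\<xi>. ennreal (norm (F n \<xi>)) + ennreal (norm (G n \<xi>)) \<partial>lborel)"
        unfolding FSuc by (intro nn_integral_mono) (simp add: norm_triangle_ineq4 ennreal_leI flip: ennreal_plus)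
      also have "\<dots> = (\<integral>\<^sup>+\<xi>. ennreal (norm (F n \<xi>)) \<partial>lborel) + (\<integral>\<^sup>+\<xi>. ennreal (norm (G n \<xi>)) \<partial>lborel)"
        by (rule nn_integral_add) measurable
      also have "\<dots> \<le> ennreal (4 ^ n * L) + ennreal (3 * (4 ^ n * L))"
        using Suc.IH G by (intro add_mono) auto
      also have "\<dots> = ennreal (4 ^ Suc n * L)" using L0 by (subst ennreal_plus[symmetric]) auto
      finally show ?thesis .
    qed
    ultimately show ?case by (simp add: algebra_simps)
  qed
  note GB = Gstep[OF conjunct1[OF FB] conjunct2[OF FB]]
  define a where "a j \<xi> = (case j of 0 \<Rightarrow> norm (F 0 \<xi>) | Suc i \<Rightarrow> norm (G i \<xi>))" for j \<xi>
  define M where "M j = (case j of 0 \<Rightarrow> S | Suc i \<Rightarrow> 10 * d i * (4 ^ i * S))" for j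
  define L' where "L' j = (case j of 0 \<Rightarrow> L | Suc i \<Rightarrow> 3 * (4 ^ i * L))" for j
  have Fle: "norm (F n \<xi>) \<le> (\<Sum>j<Suc n. a j \<xi>)" for n \<xi>
  proof (induction n)
    case (Suc n)
    have "norm (F (Suc n) \<xi>) \<le> norm (F n \<xi>) + norm (G n \<xi>)" unfolding FSuc by (rule norm_triangle_ineq4)
    with Suc show ?case by (simp add: a_def)
  qed (simp add: a_def)
  have am: "a j \<in> borel_measurable borel" for j by (cases j) (simp_all add: a_def[abs_def])

  define f where "f x = lim (\<lambda>n. p n x)" for x
  have p01: "0 \<le> p n x" "p n x \<le> 1" for n x using prof[of n] by (auto simp: profile_def)
  have plim: "(\<lambda>n. p n x) \<longlonglongrightarrow> f x" for x
  proof -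
    have "decseq (\<lambda>n. p n x)"
      using g p01 by (intro decseq_SucI) (simp add: pSuc)
    moreover have "\<forall>n. 0 \<le> p n x" using p01 by simp
    ultimately obtain l where "(\<lambda>n. p n x) \<longlonglongrightarrow> l" by (rule decseq_convergent)
    then show ?thesis unfolding f_def by (simp add: limI)
  qed
  have fm [measurable]: "f \<in> borel_measurable borel"
    by (rule borel_measurable_LIMSEQ_metric[OF _ plim]) measurable
  have pf: "profile f"
    unfolding profile_def
  proof (intro conjI allI impI fm)
    show "0 \<le> f x" "f x \<le> 1" for x
      using p01 by (auto intro: LIMSEQ_le_const[OF plim] LIMSEQ_le_const2[OF plim])
    show "f x = 0" if "x \<notin> {0..1}" for x
    proof -
      have "p n x = 0" for n using prof[of n] that unfolding profile_def by blast
      then show ?thesis using plim[of x] by (simp add: LIMSEQ_const_iff)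
    qed
  qed
  have pind: "norm (p n x) \<le> indicator {0..1} x" for n x
    using profile_le_indicator[OF prof] by simp
  have Flim: "(\<lambda>n. F n \<xi>) \<longlonglongrightarrow> ft f \<xi>" for \<xi>
    unfolding F_def ft_def
  proof (rule integral_dominated_convergence[where w = "indicator {0..1}"])
    show "AE x in lborel. (\<lambda>n. complex_of_real (p n x) * exp (- (\<i> * complex_of_real x * complex_of_real \<xi>)))
        \<longlonglongrightarrow> complex_of_real (f x) * exp (- (\<i> * complex_of_real x * complex_of_real \<xi>))"
      by (intro AE_I2 tendsto_intros plim)
    show "AE x in lborel. norm (complex_of_real (p n x) * exp (- (\<i> * complex_of_real x * complex_of_real \<xi>)))
        \<le> indicator {0..1} x" for n
      using pind by (simp add: norm_mult)
  qed (simp_all add: integrable_unit_interval)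
  have Ilim: "(\<lambda>n. \<integral>x. p n x \<partial>lborel) \<longlonglongrightarrow> (\<integral>x. f x \<partial>lborel)"
    by (rule integral_dominated_convergence[where w = "indicator {0..1}"])
       (use pind plim in \<open>simp_all add: integrable_unit_interval\<close>)
  have Ip: "(\<integral>x. p n x \<partial>lborel) \<ge> 1 / 6 - 3 * (\<Sum>j<n. d j)" for n
  proof (induction n)
    case 0
    then show ?case by (simp add: p0 integral_parabola)
  next
    case (Suc n)
    have pg: "profile (\<lambda>x. indicator {0..1} x * g n x)"
      by (rule profile_mult[OF profile_indicator]) (use g in auto)
    have "(\<integral>x. p n x * g n x \<partial>lborel) \<le> (\<integral>x. indicator {0..1} x * g n x \<partial>lborel)"
    proof (rule integral_mono[OF profile_integrable[OF profg] profile_integrable[OF pg]])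
      show "p n x * g n x \<le> indicator {0..1} x * g n x" for x
        using pind[of n x] p01[of n x] g by (intro mult_right_mono) auto
    qed
    also have "\<dots> = 3 * d n"
      unfolding g_eq integral_dilated_cos_series[OF h(1) N] by (simp add: h(4) d_def)
    finally have "(\<integral>x. p n x * g n x \<partial>lborel) \<le> 3 * d n" .
    moreover have "(\<integral>x. p (Suc n) x \<partial>lborel) = (\<integral>x. p n x \<partial>lborel) - (\<integral>x. p n x * g n x \<partial>lborel)"
      unfolding pSuc by (rule Bochner_Integration.integral_diff) (auto intro: profile_integrable prof profg)
    ultimately show ?case using Suc.IH by simp
  qed
  \<comment> \<open>The total loss of mass \<open>3 / 40\<close> stays below the initial mass \<open>1 / 6\<close>.\<close>
  have dsum: "(\<Sum>j<n. d j) \<le> 1 / 40" for n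
  proof -
    have "(\<Sum>j<n. d j) \<le> (\<Sum>j<n. (1 / 2) ^ j / 80)"
    proof (intro sum_mono)
      fix j :: nat
      have "j \<le> j\<^sup>2" by (cases j) (simp_all add: power2_eq_square)
      then have "(1 / 2 :: real) ^ (j\<^sup>2) \<le> (1 / 2) ^ j" by (intro power_decreasing) auto
      then show "d j \<le> (1 / 2) ^ j / 80" by (simp add: d_def)
    qed
    also have "\<dots> = (\<Sum>j<n. (1 / 2) ^ j) / 80" by (simp add: sum_divide_distrib)
    also have "(\<Sum>j<n. (1 / 2 :: real) ^ j) \<le> 2"
      by (simp add: geometric_sum)
    finally show ?thesis by simp
  qed
  show ?thesis
  proof (rule that[OF pf])
    have "(1 / 6 - 3 / 40 :: real) \<le> (\<integral>x. f x \<partial>lborel)"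
    proof (rule LIMSEQ_le_const[OF Ilim], intro exI allI impI)
      fix n show "(1 / 6 - 3 / 40 :: real) \<le> (\<integral>x. p n x \<partial>lborel)"
        using Ip[of n] dsum[of n] by linarith
    qed
    then show "(\<integral>x. f x \<partial>lborel) > 0" by linarith
  next
    fix r :: real assume r: "r > 1"
    show "integrable lborel (\<lambda>\<xi>. norm (ft f \<xi>) powr r)"
    proof (rule Lp_of_layers[OF r ft_measurable[OF pf] am, where M = M and L = L'])
      show "0 \<le> a j \<xi>" for j \<xi> by (cases j) (simp_all add: a_def)
      show "a j \<xi> \<le> M j" for j \<xi>
        using lattice_bounded_norm[OF conjunct1[OF FB[of 0]], of \<xi>] GB by (cases j) (simp_all add: a_def M_def)
      show "(\<integral>\<^sup>+\<xi>. ennreal (a j \<xi>) \<partial>lborel) \<le> ennreal (L' j)" for j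
        using conjunct2[OF FB[of 0]] GB by (cases j) (simp_all add: a_def L'_def)
      show "0 \<le> L' j" for j using L0 by (cases j) (simp_all add: L'_def)
      show "summable (\<lambda>j. (2 powr r) ^ Suc j * (M j powr (r - 1) * L' j))"
        using layer_summable[OF S0 r, of L]
        by (subst summable_Suc_iff[symmetric]) (simp only: M_def L'_def d_def nat.case)
      \<comment> \<open>\<open>F n\<close> consists of \<open>n + 1\<close> layers, so the approximants are shifted by one index.\<close>
      show "(\<lambda>n. case n of 0 \<Rightarrow> 0 | Suc n \<Rightarrow> F n \<xi>) \<longlonglongrightarrow> ft f \<xi>" for \<xi>
        by (rule LIMSEQ_imp_Suc) (simp add: Flim)
      show "norm (case n of 0 \<Rightarrow> 0 | Suc n \<Rightarrow> F n \<xi>) \<le> (\<Sum>j<n. a j \<xi>)" for n \<xi>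
        using Fle[of "n - 1" \<xi>] by (cases n) simp_all
    qed
  next
    fix j x assume "\<eta> j (real (N j) * x) = 1"
    then have "p n x = 0" if "n > j" for n
      using that unfolding p_def g_def by (auto intro!: prod_zero bexI[of _ j])
    then have "(\<lambda>n. p n x) \<longlonglongrightarrow> 0"
      by (intro tendsto_eventually) (auto simp: eventually_at_top_dense)
    then show "f x = 0" using plim LIMSEQ_unique by blast
  qed
qed

section \<open>Uniqueness under one-sided decay\<close>

text \<open>
  For every \<open>n\<close>, the value at \<open>\<xi>\<close> is isolated as the term \<open>k = 0\<close> of a series whose sum is
  \<open>O(1 / n)\<close>, since the series is small on \<open>E\<close>, and whose other terms together are at most \<open>1 / (n + 1)\<close>, since
  they involve frequencies beyond \<open>N n\<close> only.
\<close>

lemma fourier_transform_vanishes: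
  fixes c :: "nat \<Rightarrow> nat \<Rightarrow> complex" and N :: "nat \<Rightarrow> nat" and \<Omega> :: "real \<Rightarrow> real"
  assumes \<nu>: "\<nu> \<in> measures_supported_in E" and E: "E \<in> sets borel"
    and c: "\<And>n. summable (\<lambda>k. norm (c n k))" "\<And>n. c n 0 = 1"
    and small: "\<And>n x. x \<in> E \<Longrightarrow> norm (\<Sum>k. c n k * exp (- (\<i> * complex_of_real (2 * pi * N n * x))) ^ k) \<le> 1 / Suc n"
    and N: "\<And>n. N n \<ge> Suc n"
    and \<Omega>: "\<And>n t. t \<ge> real (N n) \<Longrightarrow> \<Omega> t \<le> 1 / (Suc n * ((\<Sum>k. norm (c n k)) + 1))"
    and decay: "\<And>\<xi>. \<xi> > 0 \<Longrightarrow> norm (fourier_transform \<nu> \<xi>) \<le> \<Omega> \<xi>"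
  shows "fourier_transform \<nu> \<xi> = 0"
proof -
  obtain V where V: "\<forall>c s \<epsilon> \<xi>. summable (\<lambda>k. norm (c k)) \<longrightarrow>
      (\<forall>x\<in>E. norm (\<Sum>k. c k * exp (- (\<i> * complex_of_real x * complex_of_real (real k * s)))) \<le> \<epsilon>) \<longrightarrow>
      (\<exists>L. (\<lambda>k. c k * fourier_transform \<nu> (\<xi> + real k * s)) sums L \<and> norm L \<le> \<epsilon> * V)"
    using fourier_synthesis[OF \<nu> E] by (rule exE)
  have bound: "norm (fourier_transform \<nu> \<xi>) \<le> (V + 1) / Suc n" if n: "n \<ge> nat \<lceil>\<bar>\<xi>\<bar>\<rceil>" for n
  proof -
    define C where "C = (\<Sum>k. norm (c n k))"
    define s where "s = 2 * pi * N n"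
    have C0: "0 \<le> C" unfolding C_def by (intro suminf_nonneg c) auto
    have "norm (\<Sum>k. c n k * exp (- (\<i> * complex_of_real x * complex_of_real (real k * s)))) \<le> 1 / Suc n"
      if "x \<in> E" for x
    proof -
      have "exp (- (\<i> * complex_of_real x * complex_of_real (real k * s)))
          = exp (- (\<i> * complex_of_real (2 * pi * N n * x))) ^ k" for k
        by (simp add: s_def mult_ac flip: exp_of_nat_mult)
      then show ?thesis using small[OF that, of n] by simp
    qed
    then have "\<exists>L. (\<lambda>k. c n k * fourier_transform \<nu> (\<xi> + real k * s)) sums L \<and> norm L \<le> 1 / Suc n * V"
      by (intro V[rule_format] c(1)) simp
    then obtain L where L: "(\<lambda>k. c n k * fourier_transform \<nu> (\<xi> + real k * s)) sums L"
      and nL: "norm L \<le> 1 / Suc n * V" by blast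
    define u where "u k = c n (Suc k) * fourier_transform \<nu> (\<xi> + real (Suc k) * s)" for k
    have u: "u sums (L - fourier_transform \<nu> \<xi>)"
      using L c(2) sums_Suc_iff[of "\<lambda>k. c n k * fourier_transform \<nu> (\<xi> + real k * s)" "L - fourier_transform \<nu> \<xi>"]
      by (simp add: u_def[abs_def])
    have nu: "norm (u k) \<le> norm (c n (Suc k)) * (1 / (Suc n * (C + 1)))" for k
    proof -
      \<comment> \<open>One step \<open>s = 2\<pi> N\<close> to the right dominates \<open>N + |\<xi>|\<close>, because \<open>|\<xi>| \<le> n < N\<close>.\<close>
      have "6 * real (N n) \<le> s" unfolding s_def using pi_gt3 by (intro mult_right_mono) auto
      also have "s \<le> real (Suc k) * s" using mult_right_mono[of 1 "real (Suc k)" s] by (simp add: s_def)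
      finally have "6 * real (N n) \<le> real (Suc k) * s" .
      moreover have "\<bar>\<xi>\<bar> \<le> real n" using n by linarith
      moreover have "real (Suc n) \<le> real (N n)" using N[of n] by linarith
      ultimately have t: "\<xi> + real (Suc k) * s \<ge> N n" "\<xi> + real (Suc k) * s > 0" by linarith+
      show ?thesis
        unfolding u_def norm_mult C_def
        by (intro mult_left_mono order_trans[OF decay[OF t(2)] \<Omega>[OF t(1)]]) auto
    qed
    have sm: "summable (\<lambda>k. norm (c n (Suc k)))" using c(1)[of n] summable_Suc_iff[of "\<lambda>k. norm (c n k)"] by blast
    have "norm (L - fourier_transform \<nu> \<xi>) \<le> (\<Sum>k. norm (c n (Suc k)) * (1 / (Suc n * (C + 1))))"
      using norm_suminf_le[OF nu summable_mult2[OF sm]] u by (simp add: sums_iff)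
    also have "\<dots> = (\<Sum>k. norm (c n (Suc k))) * (1 / (Suc n * (C + 1)))"
      by (rule suminf_mult2[OF sm, symmetric])
    also have "\<dots> \<le> (C + 1) * (1 / (Suc n * (C + 1)))"
      using suminf_split_head[OF c(1), of n] C0 by (intro mult_right_mono) (auto simp: C_def c(2))
    also have "\<dots> = 1 / Suc n"
    proof -
      have "C + 1 \<noteq> 0" using C0 by linarith
      then show ?thesis by simp
    qed
    finally have "norm (L - fourier_transform \<nu> \<xi>) \<le> 1 / Suc n" .
    then have "norm (fourier_transform \<nu> \<xi>) \<le> 1 / Suc n * V + 1 / Suc n"
      using nL norm_triangle_ineq2[of "fourier_transform \<nu> \<xi>" L] by (simp add: norm_minus_commute)
    then show ?thesis by (simp add: add_divide_distrib)
  qed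
  have "(\<lambda>n. (V + 1) / real (Suc n)) \<longlonglongrightarrow> 0"
    using tendsto_mult_left[OF LIMSEQ_inverse_real_of_nat, of "V + 1"] by (simp add: divide_inverse)
  then have "norm (fourier_transform \<nu> \<xi>) \<le> 0"
    by (rule LIMSEQ_le_const) (use bound in blast)
  then show ?thesis by simp
qed

section \<open>The set and the measure\<close>

lemma density_measure_fourier:
  fixes f :: "real \<Rightarrow> real"
  assumes f: "profile f"
  defines "D \<equiv> density lborel (\<lambda>x. ennreal (f x))"
  shows "finite_measure D" "\<And>A. A \<in> sets borel \<Longrightarrow> (\<And>x. x \<in> A \<Longrightarrow> f x = 0) \<Longrightarrow> measure D A = 0"
    "measure D UNIV = (\<integral>x. f x \<partial>lborel)"
    "fourier_transform (\<lambda>A. complex_of_real (measure D A)) \<xi> = ft f \<xi>"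
proof -
  have [measurable]: "f \<in> borel_measurable borel" using f by (rule profile_measurable)
  have f0: "0 \<le> f x" for x using f by (simp add: profile_def)
  have sD: "sets D = sets borel" "space D = UNIV" by (simp_all add: D_def)
  have "emeasure D UNIV = (\<integral>\<^sup>+x. ennreal (f x) \<partial>lborel)" by (simp add: D_def emeasure_density)
  also have "\<dots> = ennreal (\<integral>x. f x \<partial>lborel)"
    using f0 by (intro nn_integral_eq_integral profile_integrable[OF f]) auto
  finally have e: "emeasure D UNIV = ennreal (\<integral>x. f x \<partial>lborel)" .
  show "measure D UNIV = (\<integral>x. f x \<partial>lborel)"
    using f0 by (simp add: measure_def e integral_nonneg_AE)
  show fin: "finite_measure D" by (rule finite_measureI) (simp add: e sD)
  show "measure D A = 0" if "A \<in> sets borel" "\<And>x. x \<in> A \<Longrightarrow> f x = 0" for A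
  proof -
    have "emeasure D A = (\<integral>\<^sup>+x. ennreal (f x) * indicator A x \<partial>lborel)"
      using that(1) by (simp add: D_def emeasure_density)
    also have "\<dots> = (\<integral>\<^sup>+x. 0 \<partial>(lborel :: real measure))"
    proof (rule nn_integral_cong)
      show "ennreal (f x) * indicator A x = 0" for x
        using that(2)[of x] by (cases "x \<in> A") simp_all
    qed
    finally show ?thesis by (simp add: measure_def)
  qed
  have "upper_variation borel \<sigma> = upper_variation D \<sigma>" for \<sigma>
    by (simp add: upper_variation_def sD)
  then have "fourier_transform (\<lambda>A. complex_of_real (measure D A)) \<xi>
      = complex_measure_integral D (\<lambda>A. complex_of_real (measure D A))
          (\<lambda>x. exp (- (\<i> * complex_of_real x * complex_of_real \<xi>)))"
    by (simp only: fourier_transform_def complex_measure_integral_def)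
  also have "\<dots> = (\<integral>x. exp (- (\<i> * complex_of_real x * complex_of_real \<xi>)) \<partial>D)"
    by (rule complex_measure_integral_of_finite_measure[OF fin])
  also have "\<dots> = ft f \<xi>"
    unfolding D_def ft_def using f0 by (subst integral_density) (auto simp: scaleR_conv_of_real)
  finally show "fourier_transform (\<lambda>A. complex_of_real (measure D A)) \<xi> = ft f \<xi>" .
qed

theorem theorem5p2:
  fixes \<Omega> :: "real \<Rightarrow> real"
  assumes nonneg: "\<And>t. t \<ge> 0 \<Longrightarrow> \<Omega> t \<ge> 0"
    and noninc: "antimono_on {0..} \<Omega>"
    and doubling: "\<exists>C\<ge>1. \<forall>t\<ge>0. inverse C * \<Omega> t \<le> \<Omega> (t / 2) \<and> \<Omega> (t / 2) \<le> C * \<Omega> t"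
    and lim: "(\<Omega> \<longlongrightarrow> 0) at_top"
  shows "\<exists>E :: real set. compact E \<and> emeasure lborel E > 0 \<and>
    (\<exists>\<mu> \<in> measures_supported_in E.
        (\<forall>A \<in> sets borel. \<mu> A \<in> \<real>\<^sub>\<ge>\<^sub>0) \<and> (\<exists>A \<in> sets borel. \<mu> A \<noteq> 0) \<and>
        fourier_transform \<mu> \<in> (\<Inter>r\<in>{1<..}. Lp_functions r)) \<and>
    (\<forall>\<nu> \<in> measures_supported_in E.
        (\<forall>\<xi>>0. norm (fourier_transform \<nu> \<xi>) \<le> \<Omega> \<xi>) \<longrightarrow>
        (\<forall>A \<in> sets borel. \<nu> A = 0))"
proof -
  define \<delta> :: "nat \<Rightarrow> real" where "\<delta> n = (1 / 2) ^ (n\<^sup>2) / 80" for n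
  have \<delta>: "0 < \<delta> n" "\<delta> n \<le> 1 / 4" for n
    using power_le_one[of "1 / 2 :: real" "n\<^sup>2"] by (simp_all add: \<delta>_def)
  have cos_less: "cos (2 * pi * \<delta> n) < 1" for n
  proof -
    have "cos (2 * pi * \<delta> n) < cos 0" using \<delta>[of n] by (intro cos_monotone_0_pi) auto
    then show ?thesis by simp
  qed

  have "\<exists>c. summable (\<lambda>k. norm (c k)) \<and> c 0 = 1 \<and>
      (\<forall>w. norm w = 1 \<longrightarrow> Re w \<le> cos (2 * pi * \<delta> n) \<longrightarrow> norm (\<Sum>k. c k * w ^ k) \<le> 1 / Suc n)" for n
    by (rule outer_function_small_off_arc[OF cos_less[of n], of "1 / Suc n"]) (simp, blast)
  then obtain c :: "nat \<Rightarrow> nat \<Rightarrow> complex" where c: "\<And>n. summable (\<lambda>k. norm (c n k))" "\<And>n. c n 0 = 1"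
    and c_small: "\<And>n w. norm w = 1 \<Longrightarrow> Re w \<le> cos (2 * pi * \<delta> n) \<Longrightarrow> norm (\<Sum>k. c n k * w ^ k) \<le> 1 / Suc n"
    by metis

  \<comment> \<open>\<open>N n\<close> is so large that the decay beyond it beats the absolute sum of the coefficients \<open>c n\<close>.\<close>
  have "\<exists>N. N \<ge> Suc n \<and> (\<forall>t\<ge>real N. \<Omega> t \<le> 1 / (Suc n * ((\<Sum>k. norm (c n k)) + 1)))" for n
  proof -
    have "0 < 1 / (Suc n * ((\<Sum>k. norm (c n k)) + 1))"
      using suminf_nonneg[OF c(1)[of n]] by (intro divide_pos_pos mult_pos_pos add_nonneg_pos) auto
    then have "\<forall>\<^sub>F t in at_top. \<Omega> t < 1 / (Suc n * ((\<Sum>k. norm (c n k)) + 1))"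
      by (rule order_tendstoD(2)[OF lim])
    then obtain T where T: "\<And>t. t \<ge> T \<Longrightarrow> \<Omega> t < 1 / (Suc n * ((\<Sum>k. norm (c n k)) + 1))"
      by (auto simp: eventually_at_top_linorder)
    have "T \<le> real (max (Suc n) (nat \<lceil>T\<rceil>))" by linarith
    then have "\<forall>t\<ge>real (max (Suc n) (nat \<lceil>T\<rceil>)). \<Omega> t \<le> 1 / (Suc n * ((\<Sum>k. norm (c n k)) + 1))"
      using T by (meson less_imp_le order_trans)
    then show ?thesis by (intro exI[of _ "max (Suc n) (nat \<lceil>T\<rceil>)"]) simp
  qed
  then obtain N where N: "\<And>n. N n \<ge> Suc n"
    and N_decay: "\<And>n t. t \<ge> real (N n) \<Longrightarrow> \<Omega> t \<le> 1 / (Suc n * ((\<Sum>k. norm (c n k)) + 1))"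
    by metis

  \<comment> \<open>The conclusion of \<open>wiener_bump\<close> as a single predicate, so that a choice can be made for all \<open>n\<close>.\<close>
  define bump where "bump d h \<longleftrightarrow> summable (\<lambda>k. \<bar>h k\<bar>) \<and> (\<Sum>k. \<bar>h k\<bar>) \<le> 3 \<and> (\<forall>k. \<bar>h k\<bar> \<le> 10 * d) \<and> h 0 = 3 * d \<and>
      (\<forall>x. 0 \<le> (\<Sum>k. h k * cos (2 * pi * real k * x))) \<and> (\<forall>x. (\<Sum>k. h k * cos (2 * pi * real k * x)) \<le> 1) \<and>
      (\<forall>x. cos (2 * pi * d) < cos (2 * pi * x) \<longrightarrow> (\<Sum>k. h k * cos (2 * pi * real k * x)) = 1)"
    for d :: real and h :: "nat \<Rightarrow> real"
  have "\<exists>h. bump (\<delta> n) h" for n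
    unfolding bump_def by (rule wiener_bump[OF \<delta>]) blast
  then obtain h where "\<And>n. bump (\<delta> n) (h n)" by metis
  then have h: "\<And>n. summable (\<lambda>k. \<bar>h n k\<bar>)" "\<And>n. (\<Sum>k. \<bar>h n k\<bar>) \<le> 3"
      "\<And>n k. \<bar>h n k\<bar> \<le> 10 * \<delta> n" "\<And>n. h n 0 = 3 * \<delta> n"
      "\<And>n x. 0 \<le> (\<Sum>k. h n k * cos (2 * pi * real k * x))"
      "\<And>n x. (\<Sum>k. h n k * cos (2 * pi * real k * x)) \<le> 1"
      "\<And>n x. cos (2 * pi * \<delta> n) < cos (2 * pi * x) \<Longrightarrow> (\<Sum>k. h n k * cos (2 * pi * real k * x)) = 1"
    unfolding bump_def by simp_all

  have N1: "N n \<ge> 1" for n using N[of n] by simp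
  obtain f where f: "profile f" and f_pos: "(\<integral>x. f x \<partial>lborel) > 0"
    and f_Lp: "\<And>r. r > 1 \<Longrightarrow> integrable lborel (\<lambda>\<xi>. norm (ft f \<xi>) powr r)"
    and f_zero: "\<And>n x. (\<Sum>k. h n k * cos (2 * pi * real k * (real (N n) * x))) = 1 \<Longrightarrow> f x = 0"
    by (rule wiener_product[OF h(1,2) h(3,4)[unfolded \<delta>_def] h(5,6) N1]) (rule that)

  \<comment> \<open>The defining inequalities are closed conditions, and each of them fails only where the factor \<open>1 - \<eta>\<^sub>n(N\<^sub>n x)\<close> of \<open>f\<close> vanishes.\<close>
  define E where "E = {0..1} \<inter> (\<Inter>n. {x::real. cos (2 * pi * N n * x) \<le> cos (2 * pi * \<delta> n)})"
  have E: "compact E"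
    unfolding E_def
    by (intro compact_Int_closed compact_Icc closed_INT ballI closed_Collect_le continuous_intros)
  then have E_borel: "E \<in> sets borel" by (simp add: borel_compact)
  have f_E: "f x = 0" if "x \<notin> E" for x
  proof (cases "x \<in> {0..1}")
    case True
    then obtain n where "cos (2 * pi * \<delta> n) < cos (2 * pi * N n * x)"
      using \<open>x \<notin> E\<close> by (auto simp: E_def not_le)
    then show ?thesis using h(7)[of n "real (N n) * x"] f_zero[of n x] by (simp add: mult.assoc)
  next
    case False
    then show ?thesis using f unfolding profile_def by blast
  qed

  have E_pos: "emeasure lborel E > 0"
  proof -
    have i: "integrable lborel (indicator E :: real \<Rightarrow> real)"
      using E E_borel emeasure_compact_finite[OF E] by (simp add: integrable_indicator_iff)
    have "(\<integral>x. f x \<partial>lborel) \<le> (\<integral>x. indicator E x \<partial>lborel)"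
    proof (rule integral_mono[OF profile_integrable[OF f] i])
      show "f x \<le> indicator E x" for x
        using f f_E[of x] by (cases "x \<in> E") (auto simp: profile_def)
    qed
    then have "measure lborel E > 0" using f_pos by simp
    then show ?thesis by (simp add: measure_def enn2real_positive_iff)
  qed

  define D where "D = density lborel (\<lambda>x. ennreal (f x))"
  note D = density_measure_fourier[OF f, folded D_def]
  interpret D: finite_measure D by (rule D(1))
  have sets_D: "sets D = sets borel" by (simp add: D_def)
  define \<mu> where "\<mu> A = complex_of_real (measure D A)" for A
  have \<mu>: "\<mu> \<in> measures_supported_in E"
    unfolding measures_supported_in_def complex_measure_def \<mu>_def
  proof (intro CollectI conjI allI impI ballI)
    fix A :: "nat \<Rightarrow> real set" assume "range A \<subseteq> sets borel" "disjoint_family A"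
    then show "(\<lambda>i. complex_of_real (measure D (A i))) sums complex_of_real (measure D (\<Union>i. A i))"
      by (intro sums_of_real D.finite_measure_UNION) (simp_all add: sets_D)
  next
    fix A :: "real set" assume "A \<in> sets borel" "A \<inter> E = {}"
    then show "complex_of_real (measure D A) = 0" using D(2)[of A] f_E by auto
  qed
  have "fourier_transform \<mu> = ft f" using D(4) by (auto simp: \<mu>_def[abs_def])
  then have \<mu>_Lp: "fourier_transform \<mu> \<in> (\<Inter>r\<in>{1<..}. Lp_functions r)"
    using f_Lp ft_measurable[OF f] by (auto simp: Lp_functions_def)

  have unique: "\<forall>A \<in> sets borel. \<nu> A = 0"
    if \<nu>: "\<nu> \<in> measures_supported_in E" and decay: "\<forall>\<xi>>0. norm (fourier_transform \<nu> \<xi>) \<le> \<Omega> \<xi>" for \<nu>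
  proof (intro ballI complex_measure_zero_of_fourier_zero[OF \<nu> E_borel])
    fix \<xi>
    show "fourier_transform \<nu> \<xi> = 0"
    proof (rule fourier_transform_vanishes[OF \<nu> E_borel c _ N N_decay])
      fix n x assume "x \<in> E"
      then show "norm (\<Sum>k. c n k * exp (- (\<i> * complex_of_real (2 * pi * N n * x))) ^ k) \<le> 1 / Suc n"
        by (intro c_small) (auto simp: E_def Re_exp)
    next
      fix \<xi>' :: real assume "0 < \<xi>'"
      then show "norm (fourier_transform \<nu> \<xi>') \<le> \<Omega> \<xi>'" using decay by blast
    qed
  qed

  show ?thesis
  proof (intro exI[of _ E] conjI bexI[of _ \<mu>] ballI impI)
    show "\<mu> A \<in> \<real>\<^sub>\<ge>\<^sub>0" for A by (simp add: \<mu>_def)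
    show "\<exists>A \<in> sets borel. \<mu> A \<noteq> 0"
      using f_pos D(3) by (intro bexI[of _ UNIV]) (auto simp: \<mu>_def)
  qed (use E E_pos \<mu> \<mu>_Lp unique in blast)+
qed

end
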